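(* A minimal set $A\subset\mathbb{Z}^2$ is mortal if and only if its enclosing box $\operatorname{enc}(A)$ is dead.
   Context: $X$ is the graph with vertex set $\mathbb{Z}^2$ in which $(x,y)$ and $(x',y')$ are adjacent iff $|x-x'|+|y-y'|=1$. For $A\subset\mathbb{Z}^2$, $\partial A=\{u\in\mathbb{Z}^2\setminus A:\ u \text{ adjacent to some } v\in A\}$. A finite nonempty set $A$ is minimal if $|\partial A|\le|\partial C|$ for all $C$ with $|C|=|A|$. For integers $a,b,c,d$, $B(a,b,c,d)=\{(x,y): a\le y-x\le b,\ c\le y+x\le d\}$; a box is a nonempty set of this form; $\operatorname{enc}(A)$ is the smallest box containing $A$. The life expectancy of a minimal set $A$ is the supremum (in $\mathbb{N}\cup\{\infty\}$) of all $n$ such that there is a nested sequence $A=A_0\subset\dots\subset A_n$ of minimal sets with $|A_i|=|A|+i$. $A$ is mortal if its life expectancy is finite and dead if it is $0$. *)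

theory Defs
  imports Main "HOL-Library.Extended_Nat"
begin

type_synonym point = "int \<times> int"

definition adjacent :: "point \<Rightarrow> point \<Rightarrow> bool" where
  "adjacent p q \<longleftrightarrow> \<bar>fst p - fst q\<bar> + \<bar>snd p - snd q\<bar> = 1"

definition vboundary :: "point set \<Rightarrow> point set" where
  "vboundary A = {u. u \<notin> A \<and> (\<exists>v\<in>A. adjacent u v)}"

definition minimal :: "point set \<Rightarrow> bool" where
  "minimal A \<longleftrightarrow> finite A \<and> A \<noteq> {} \<and>
     (\<forall>C. finite C \<and> card C = card A \<longrightarrow> card (vboundary A) \<le> card (vboundary C))"

definition Box :: "int \<Rightarrow> int \<Rightarrow> int \<Rightarrow> int \<Rightarrow> point set" where
  "Box a b c d = {(x, y). a \<le> y - x \<and> y - x \<le> b \<and> c \<le> y + x \<and> y + x \<le> d}"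

definition is_box :: "point set \<Rightarrow> bool" where
  "is_box E \<longleftrightarrow> E \<noteq> {} \<and> (\<exists>a b c d. E = Box a b c d)"

text \<open>The order on sets is inclusion, so \<open>LEAST\<close> is the smallest box; lemma \<open>enc_smallest_box\<close>
  shows that it exists for finite nonempty sets.\<close>

definition enc :: "point set \<Rightarrow> point set" where
  "enc A = (LEAST E. is_box E \<and> A \<subseteq> E)"

lemma enc_smallest_box:
  assumes "finite A" "A \<noteq> {}"
  shows "is_box (enc A)" "A \<subseteq> enc A" "\<And>E. is_box E \<Longrightarrow> A \<subseteq> E \<Longrightarrow> enc A \<subseteq> E"
proof -
  let ?u = "(\<lambda>(x, y). y - x) ` A" and ?v = "(\<lambda>(x, y). y + x) ` A"
  let ?E = "Box (Min ?u) (Max ?u) (Min ?v) (Max ?v)"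
  have fin: "finite ?u" "?u \<noteq> {}" "finite ?v" "?v \<noteq> {}"
    using assms by auto
  have sub: "A \<subseteq> ?E"
  proof
    fix p assume p: "p \<in> A"
    obtain x y where xy: "p = (x, y)" by (cases p)
    have "y - x \<in> ?u" "y + x \<in> ?v" using p xy by force+
    then show "p \<in> ?E" using fin xy by (auto simp: Box_def)
  qed
  have least: "?E \<subseteq> E" if E: "is_box E" "A \<subseteq> E" for E
  proof -
    obtain a b c d where abcd: "E = Box a b c d" using E by (auto simp: is_box_def)
    have "\<forall>u\<in>?u. a \<le> u \<and> u \<le> b" "\<forall>v\<in>?v. c \<le> v \<and> v \<le> d"
      using E abcd by (auto simp: Box_def)
    then have "a \<le> Min ?u" "Max ?u \<le> b" "c \<le> Min ?v" "Max ?v \<le> d"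
      using fin by auto
    then show ?thesis unfolding abcd Box_def by auto
  qed
  have box: "is_box ?E" using sub assms unfolding is_box_def by blast
  have eq: "enc A = ?E"
    unfolding enc_def by (rule Least_equality) (use sub box least in auto)
  show "is_box (enc A)" "A \<subseteq> enc A" "\<And>E. is_box E \<Longrightarrow> A \<subseteq> E \<Longrightarrow> enc A \<subseteq> E"
    using sub box least by (simp_all only: eq)
qed

definition nested_minimal_seq :: "point set \<Rightarrow> nat \<Rightarrow> (nat \<Rightarrow> point set) \<Rightarrow> bool" where
  "nested_minimal_seq A n S \<longleftrightarrow> S 0 = A \<and> (\<forall>i<n. S i \<subseteq> S (Suc i)) \<and>
     (\<forall>i\<le>n. minimal (S i) \<and> card (S i) = card A + i)"

definition life_expectancy :: "point set \<Rightarrow> enat" where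
  "life_expectancy A = Sup {enat n | n. \<exists>S. nested_minimal_seq A n S}"

text \<open>Life expectancy is only meaningful for minimal sets (for other sets the supremum above is
  over the empty set, hence \<open>0\<close>), so both notions below include minimality.\<close>

definition mortal :: "point set \<Rightarrow> bool" where
  "mortal A \<longleftrightarrow> minimal A \<and> life_expectancy A < \<infinity>"

definition dead :: "point set \<Rightarrow> bool" where
  "dead A \<longleftrightarrow> minimal A \<and> life_expectancy A = 0"

end

theory Submission
  imports Defs
begin

text \<open>
  In the coordinates \<open>u = y - x\<close>, \<open>v = y + x\<close> the graph lives on the points with \<open>u + v\<close> even, adjacency
  is a diagonal step and boxes are axis-parallel. Write \<open>f S\<close> for the size of the boundary.

  Counting column by column gives \<open>(f S - 2)\<^sup>2 \<ge> 8 |S| - 4\<close>. Since this bound turns out to be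
  attained, \<open>S\<close> is minimal iff \<open>(f S - 3)\<^sup>2 < 8 |S| - 4\<close>; a minimal set thus stays minimal
  when a point is added without increasing \<open>f\<close>. Moreover, intersecting with a box that does not contain
  \<open>S\<close> strictly decreases \<open>f\<close>.

  Suppose \<open>S\<close> is minimal and no point can be added for free. Let \<open>E\<close> be a largest box inside \<open>S\<close>
  among those reaching the maximal value of \<open>u\<close>. A point of \<open>S - E\<close> near \<open>E\<close> would force a larger box,
  unless it sits diagonally off one of the two left corners of \<open>E\<close>. So the closed neighbourhoods of \<open>E\<close>
  and \<open>S - E\<close> share at most two points, and the isoperimetric inequality applied to both parts
  contradicts minimality. Hence \<open>S = E\<close>. Consequently every minimal \<open>A\<close> fills up to \<open>enc A\<close> through
  minimal sets with the same \<open>f\<close>, and \<open>enc A\<close> is minimal. A minimal superset of \<open>A\<close>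
  with as many points as \<open>enc A\<close> is \<open>enc A\<close> itself, so \<open>A\<close> is mortal if \<open>enc A\<close> is dead. If \<open>enc A\<close> is
  not dead, it has the largest size possible for its \<open>f\<close>; such a box is almost a square and can
  be enlarged, along its shorter side, to another box of this kind, for ever.
\<close>

text \<open>Closed neighbourhood in the rotated coordinates.\<close>

definition nhd :: "(int \<times> int) set \<Rightarrow> (int \<times> int) set" where
  "nhd S = {(u, v). (u, v) \<in> S \<or> (u - 1, v - 1) \<in> S \<or> (u - 1, v + 1) \<in> S
     \<or> (u + 1, v - 1) \<in> S \<or> (u + 1, v + 1) \<in> S}"

text \<open>Size of the boundary of a finite \<open>S\<close>, since \<open>S\<close> lies in
  \<open>nhd S\<close>. It is an integer so that differences and squares below are free of truncated
  subtraction.\<close>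

definition bsize :: "(int \<times> int) set \<Rightarrow> int" where
  "bsize S = int (card (nhd S)) - int (card S)"

lemma nhd_alt:
  "nhd S = S \<union> (\<lambda>(u, v). (u + 1, v + 1)) ` S \<union> (\<lambda>(u, v). (u + 1, v - 1)) ` S
     \<union> (\<lambda>(u, v). (u - 1, v + 1)) ` S \<union> (\<lambda>(u, v). (u - 1, v - 1)) ` S"
  unfolding nhd_def by (force simp: image_iff)

lemma finite_nhd [simp]: "finite S \<Longrightarrow> finite (nhd S)"
  by (simp add: nhd_alt)

lemma subset_nhd: "S \<subseteq> nhd S"
  by (auto simp: nhd_def)

lemma nhd_mono: "S \<subseteq> T \<Longrightarrow> nhd S \<subseteq> nhd T"
  by (auto simp: nhd_def)

lemma nhd_Un: "nhd (S \<union> T) = nhd S \<union> nhd T"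
  by (auto simp: nhd_def)

text \<open>\<open>reflect\<close> and \<open>swap_uv\<close> generate the symmetries of the square;
  later case analyses treat one side or corner and transport the result by them.\<close>

definition reflect :: "(int \<times> int) set \<Rightarrow> (int \<times> int) set" where
  "reflect S = {(u, v). (- u, v) \<in> S}"

definition swap_uv :: "(int \<times> int) set \<Rightarrow> (int \<times> int) set" where
  "swap_uv S = {(u, v). (v, u) \<in> S}"

lemma mem_reflect [simp]: "(u, v) \<in> reflect S \<longleftrightarrow> (- u, v) \<in> S"
  by (simp add: reflect_def)

lemma mem_swap_uv [simp]: "(u, v) \<in> swap_uv S \<longleftrightarrow> (v, u) \<in> S"
  by (simp add: swap_uv_def)

lemma reflect_image: "reflect S = (\<lambda>(u, v). (- u, v)) ` S"
proof
  show "reflect S \<subseteq> (\<lambda>(u, v). (- u, v)) ` S"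
  proof (clarify)
    fix u v assume "(u, v) \<in> reflect S"
    then show "(u, v) \<in> (\<lambda>(u, v). (- u, v)) ` S"
      by (intro image_eqI[of _ _ "(- u, v)"]) auto
  qed
qed auto

lemma swap_uv_image: "swap_uv S = (\<lambda>(u, v). (v, u)) ` S"
  by (auto simp: swap_uv_def image_iff split: prod.splits)

lemma card_reflect [simp]: "card (reflect S) = card S"
  unfolding reflect_image by (rule card_image) (auto simp: inj_on_def)

lemma card_swap_uv [simp]: "card (swap_uv S) = card S"
  unfolding swap_uv_image by (rule card_image) (auto simp: inj_on_def)

lemma finite_reflect [simp]: "finite S \<Longrightarrow> finite (reflect S)"
  by (simp add: reflect_image)

lemma finite_swap_uv [simp]: "finite S \<Longrightarrow> finite (swap_uv S)"
  by (simp add: swap_uv_image)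

lemma nhd_reflect: "nhd (reflect S) = reflect (nhd S)"
  by (auto simp: nhd_def reflect_def algebra_simps)

lemma nhd_swap_uv: "nhd (swap_uv S) = swap_uv (nhd S)"
  by (auto simp: nhd_def swap_uv_def)

lemma bsize_reflect [simp]: "bsize (reflect S) = bsize S"
  by (simp add: bsize_def nhd_reflect)

lemma bsize_swap_uv [simp]: "bsize (swap_uv S) = bsize S"
  by (simp add: bsize_def nhd_swap_uv)

section \<open>The isoperimetric inequality\<close>

definition shiftR :: "(int \<times> int) set \<Rightarrow> (int \<times> int) set" where
  "shiftR S = {(u, v). (u - 1, v - 1) \<in> S \<or> (u - 1, v + 1) \<in> S}"

definition shiftL :: "(int \<times> int) set \<Rightarrow> (int \<times> int) set" where
  "shiftL S = {(u, v). (u + 1, v - 1) \<in> S \<or> (u + 1, v + 1) \<in> S}"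

lemma nhd_shift: "nhd S = S \<union> shiftR S \<union> shiftL S"
  by (auto simp: nhd_def shiftR_def shiftL_def)

text \<open>A column of k \<ge> 1 points has at least k + 1 neighbours in the next column: move all
  its points up (\<open>?X\<close>) and add the one just below the lowest
  (\<open>?Y\<close>).\<close>

lemma card_shiftR:
  assumes "finite S"
  shows "card S + card (fst ` S) \<le> card (shiftR S)"
proof -
  define mn where "mn u = Min {v. (u, v) \<in> S}" for u
  have fin: "finite {v. (u, v) \<in> S}" for u
    by (rule finite_subset[of _ "snd ` S"]) (use assms in \<open>force+\<close>)
  let ?X = "(\<lambda>(u, v). (u + 1, v + 1)) ` S" and ?Y = "(\<lambda>u. (u + 1, mn u - 1)) ` fst ` S"
  have mnS: "(u, mn u) \<in> S" if "u \<in> fst ` S" for u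
  proof -
    have "{v. (u, v) \<in> S} \<noteq> {}" using that by auto
    then show ?thesis using Min_in[OF fin[of u]] unfolding mn_def by blast
  qed
  have mn_le: "mn u \<le> v" if "(u, v) \<in> S" for u v
    unfolding mn_def using fin that by auto
  have disj: "?X \<inter> ?Y = {}"
  proof -
    have "(u + 1, v + 1) \<noteq> (w + 1, mn w - 1)" if "(u, v) \<in> S" for u v w
      using mn_le[OF that] by auto
    then show ?thesis by fast
  qed
  have "card ?X = card S"
    by (rule card_image) (auto simp: inj_on_def)
  moreover have "card ?Y = card (fst ` S)"
    by (rule card_image) (auto simp: inj_on_def)
  moreover have "?X \<union> ?Y \<subseteq> shiftR S"
    using mnS by (force simp: shiftR_def)
  moreover have "finite (shiftR S)"
    using finite_nhd[OF assms] nhd_shift[of S] by auto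
  ultimately show ?thesis
    using card_Un_disjoint[OF _ _ disj] assms card_mono[of "shiftR S" "?X \<union> ?Y"] by auto
qed

lemma card_shiftL:
  assumes "finite S"
  shows "card S + card (fst ` S) \<le> card (shiftL S)"
proof -
  have "shiftL S = reflect (shiftR (reflect S))"
    by (auto simp: shiftL_def shiftR_def reflect_def algebra_simps)
  moreover have "card (fst ` reflect S) = card (fst ` S)"
  proof -
    have "fst ` reflect S = uminus ` fst ` S" by (force simp: reflect_image)
    then show ?thesis by (simp add: card_image)
  qed
  ultimately show ?thesis
    using card_shiftR[of "reflect S"] assms by simp
qed

definition col :: "(int \<times> int) set \<Rightarrow> int \<Rightarrow> (int \<times> int) set" where
  "col S u = {p \<in> S. fst p = u}"

lemma finite_col [simp]: "finite S \<Longrightarrow> finite (col S u)"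
  by (simp add: col_def)

lemma col_empty_iff: "col S u = {} \<longleftrightarrow> u \<notin> fst ` S"
  by (force simp: col_def)

lemma card_eq_sum_col:
  assumes "finite S"
  shows "card S = (\<Sum>u\<in>fst ` S. card (col S u))"
  using sum.group[of S "fst ` S" fst "\<lambda>_. 1 :: nat"] assms by (simp add: col_def)

text \<open>Push the columns from \<open>t\<close> onwards to the right and those up to
  \<open>t\<close> to the left. The two images are disjoint, each gains one point per column, and
  column \<open>t\<close> is pushed twice. \<open>Z\<close> collects further points of the
  neighbourhood that neither push reaches: those in column \<open>t\<close>, or next to no occupied
  column on the side of \<open>t\<close>.\<close>

lemma bsize_col_ge:
  assumes "finite S" "t \<in> fst ` S"
    and Z: "Z \<subseteq> nhd S" "\<And>p. p \<in> Z \<Longrightarrow> fst p = t \<or> (fst p < t \<and> fst p + 1 \<notin> fst ` S)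
      \<or> (t < fst p \<and> fst p - 1 \<notin> fst ` S)"
  shows "bsize S \<ge> int (card (fst ` S)) + 1 + int (card (col S t)) + int (card Z)"
proof -
  let ?R = "{p \<in> S. t \<le> fst p}" and ?L = "{p \<in> S. fst p \<le> t}"
  have fin: "finite ?R" "finite ?L" "finite Z"
    using assms(1) finite_subset[OF Z(1)] by auto
  have finN: "finite (shiftR ?R)" "finite (shiftL ?L)"
    using finite_nhd[OF fin(1)] finite_nhd[OF fin(2)] by (auto simp: nhd_shift)
  have d1: "shiftR ?R \<inter> shiftL ?L = {}"
    by (auto simp: shiftR_def shiftL_def)
  have d2: "(shiftR ?R \<union> shiftL ?L) \<inter> Z = {}"
  proof -
    have False if "(u, v) \<in> shiftR ?R" "(u, v) \<in> Z" for u v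
      using Z(2)[OF that(2)] that(1) by (force simp: shiftR_def)
    moreover have False if "(u, v) \<in> shiftL ?L" "(u, v) \<in> Z" for u v
      using Z(2)[OF that(2)] that(1) by (force simp: shiftL_def)
    ultimately show ?thesis by auto
  qed
  have sub: "shiftR ?R \<union> shiftL ?L \<union> Z \<subseteq> nhd S"
    using Z(1) by (auto simp: nhd_def shiftR_def shiftL_def)
  have "card (shiftR ?R) + card (shiftL ?L) + card Z \<le> card (nhd S)"
    using card_mono[OF finite_nhd[OF assms(1)] sub] card_Un_disjoint[OF _ _ d1]
      card_Un_disjoint[OF _ _ d2] fin finN by simp
  moreover have "card ?R + card ?L = card S + card (col S t)"
  proof -
    have "?R \<union> ?L = S" "?R \<inter> ?L = col S t" by (auto simp: col_def)
    then show ?thesis using card_Un_Int[OF fin(1,2)] by simp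
  qed
  moreover have "card (fst ` ?R) + card (fst ` ?L) = card (fst ` S) + 1"
  proof -
    have "fst ` ?R \<union> fst ` ?L = fst ` S" by force
    moreover have "fst ` ?R \<inter> fst ` ?L = {t}" using assms(2) by force
    ultimately show ?thesis using card_Un_Int[of "fst ` ?R" "fst ` ?L"] fin by simp
  qed
  ultimately show ?thesis
    using card_shiftR[OF fin(1)] card_shiftL[OF fin(2)] by (simp add: bsize_def)
qed

text \<open>With \<open>P\<close> occupied columns of height at most \<open>m\<close>, the size is
  at most \<open>P * m\<close> and the boundary at least \<open>P + 1 + 2 * m\<close>. This misses
  the claim by little: either one more boundary point is found, or the bound on the size
  improves.\<close>

lemma isoperimetric:
  assumes "finite S" "S \<noteq> {}"
  shows "bsize S \<ge> 4" and "(bsize S - 2)\<^sup>2 \<ge> 8 * int (card S) - 4"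
proof -
  let ?U = "fst ` S" and ?c = "\<lambda>u. card (col S u)"
  define P where "P = int (card ?U)"
  define m where "m = Max (?c ` ?U)"
  have finU: "finite ?U" "?U \<noteq> {}" using assms by auto
  have cm: "?c u \<le> m" if "u \<in> ?U" for u
    unfolding m_def using finU that by auto
  have "m \<in> ?c ` ?U" unfolding m_def using finU by (intro Max_in) auto
  then obtain t where t: "t \<in> ?U" "?c t = m" by auto
  have P1: "P \<ge> 1" using finU by (simp add: P_def Suc_leI card_gt_0_iff)
  have m1: "m \<ge> 1" using t assms by (metis One_nat_def Suc_leI card_gt_0_iff col_empty_iff finite_col)
  have n: "int (card S) \<le> P * int m"
  proof -
    have "card S \<le> card ?U * m"
      using card_eq_sum_col[OF assms(1)] sum_bounded_above[of ?U ?c m] cm by simp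
    then show ?thesis unfolding P_def by (metis of_nat_le_iff of_nat_mult)
  qed
  have colN: "col S t \<subseteq> nhd S" for t using subset_nhd by (auto simp: col_def)
  have base: "bsize S \<ge> P + 1 + 2 * int m"
    using bsize_col_ge[OF assms(1) t(1) colN[of t]] t by (auto simp: col_def P_def)
  then show "bsize S \<ge> 4" using P1 m1 by linarith
  \<comment> \<open>One point beyond \<open>base\<close> suffices, by the inequality between the
    means of \<open>P\<close> and \<open>2 * m\<close>.\<close>
  have strong: "(bsize S - 2)\<^sup>2 \<ge> 8 * int (card S) - 4" if "bsize S \<ge> P + 2 + 2 * int m"
  proof -
    have "(P + 2 * int m)\<^sup>2 \<le> (bsize S - 2)\<^sup>2"
      using that P1 by (intro power_mono) auto
    moreover have "(P + 2 * int m)\<^sup>2 = 8 * (P * int m) + (P - 2 * int m)\<^sup>2"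
      by (simp add: power2_eq_square algebra_simps)
    moreover have "0 \<le> (P - 2 * int m)\<^sup>2" by simp
    ultimately show ?thesis using n by linarith
  qed
  \<comment> \<open>\<open>twin\<close>: two adjacent tallest columns. \<open>gap\<close>: an
    occupied column cut off from \<open>t\<close>. Both supply an extra point for \<open>Z\<close>.
    \<open>solid\<close>: the occupied columns form an interval and adjacent heights add up to at
    most \<open>2 * m - 1\<close>.\<close>
  consider (twin) u where "u \<in> ?U" "u + 1 \<in> ?U" "?c u = m" "?c (u + 1) = m"
    | (gap) s where "s \<in> ?U" "(s < t \<and> s + 1 \<notin> ?U) \<or> (t < s \<and> s - 1 \<notin> ?U)"
    | (solid) "\<And>s. s \<in> ?U \<Longrightarrow> s < t \<Longrightarrow> s + 1 \<in> ?U" "\<And>s. s \<in> ?U \<Longrightarrow> t < s \<Longrightarrow> s - 1 \<in> ?U"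
      "\<And>u. u \<in> ?U \<Longrightarrow> u + 1 \<in> ?U \<Longrightarrow> ?c u + ?c (u + 1) + 1 \<le> 2 * m"
  proof -
    have "?c u + ?c (u + 1) + 1 \<le> 2 * m" if "u \<in> ?U" "u + 1 \<in> ?U" "\<not> (?c u = m \<and> ?c (u + 1) = m)" for u
      using cm[OF that(1)] cm[OF that(2)] that(3) by linarith
    then show ?thesis using that by metis
  qed
  then show "(bsize S - 2)\<^sup>2 \<ge> 8 * int (card S) - 4"
  proof cases
    case twin
    \<comment> \<open>The tallest column \<open>u + 1\<close> pushed onto \<open>u\<close> has at
      least \<open>m + 1\<close> points there, one more than column \<open>u\<close> itself.\<close>
    let ?Z = "shiftL (col S (u + 1))"
    have "?Z \<subseteq> nhd S" by (auto simp: shiftL_def col_def nhd_def)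
    moreover have "fst p = u" if "p \<in> ?Z" for p using that by (auto simp: shiftL_def col_def)
    ultimately have "bsize S \<ge> P + 1 + int m + int (card ?Z)"
      using bsize_col_ge[OF assms(1) twin(1), of ?Z] twin(3) by (auto simp: P_def)
    moreover have "fst ` col S (u + 1) = {u + 1}" using twin(2) by (auto simp: col_def)
    then have "card ?Z \<ge> m + 1" using card_shiftL[of "col S (u + 1)"] assms twin by simp
    ultimately show ?thesis by (intro strong) linarith
  next
    case gap
    let ?Z = "col S t \<union> col S s"
    have "?Z \<subseteq> nhd S" using colN by auto
    moreover have "fst p = t \<or> fst p = s" if "p \<in> ?Z" for p using that by (auto simp: col_def)
    ultimately have "bsize S \<ge> P + 1 + int m + int (card ?Z)"
      using bsize_col_ge[OF assms(1) t(1), of ?Z] gap(2) t(2) unfolding P_def by metis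
    moreover have "card ?Z = m + ?c s"
      using gap t assms by (subst card_Un_disjoint) (auto simp: col_def)
    moreover have "?c s \<ge> 1"
      using gap(1) assms by (metis One_nat_def Suc_leI card_gt_0_iff col_empty_iff finite_col)
    ultimately show ?thesis by (intro strong) linarith
  next
    case solid
    define a b where "a = Min ?U" and "b = Max ?U"
    have ab: "a \<in> ?U" "b \<in> ?U" "a \<le> t" "t \<le> b" and abU: "\<And>u. u \<in> ?U \<Longrightarrow> a \<le> u \<and> u \<le> b"
      unfolding a_def b_def using finU t by auto
    have up: "u \<in> ?U" if "a \<le> u" "u \<le> t" for u
      using that
    proof (induction u rule: int_ge_induct)
      case base show ?case using ab by simp
    next
      case (step i) then show ?case using solid(1)[of i] by simp
    qed
    have down: "u \<in> ?U" if "u \<le> b" "t \<le> u" for u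
      using that
    proof (induction u rule: int_le_induct)
      case base show ?case using ab by simp
    next
      case (step i) then show ?case using solid(2)[of i] by simp
    qed
    have U: "?U = {a..b}"
    proof
      show "{a..b} \<subseteq> ?U"
      proof
        fix x assume "x \<in> {a..b}"
        then show "x \<in> ?U" using up[of x] down[of x] by (cases "x \<le> t") auto
      qed
    qed (use abU in force)
    \<comment> \<open>Twice the sum of the heights is the sum over adjacent pairs plus the two end
      columns.\<close>
    have key: "2 * (\<Sum>u\<in>{a..w}. int (?c u)) \<le> int (?c w) + int m + (w - a) * (2 * int m - 1)"
      if "a \<le> w" "w \<le> b" for w
      using that
    proof (induction w rule: int_ge_induct)
      case base show ?case using cm[OF ab(1)] by simp
    next
      case (step i)
      have "{a..i + 1} = insert (i + 1) {a..i}" using step by auto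
      then have "(\<Sum>u\<in>{a..i + 1}. int (?c u)) = int (?c (i + 1)) + (\<Sum>u\<in>{a..i}. int (?c u))" by simp
      moreover have "?c i + ?c (i + 1) + 1 \<le> 2 * m"
        using solid(3)[of i] U step by auto
      then have "int (?c i) + int (?c (i + 1)) + 1 \<le> 2 * int m" by linarith
      ultimately show ?case using step by (simp add: algebra_simps)
    qed
    have Pab: "P = b - a + 1" using U ab by (simp add: P_def)
    have "2 * int (card S) \<le> 2 * int m + (P - 1) * (2 * int m - 1)"
      using key[of b] cm[OF ab(2)] ab card_eq_sum_col[OF assms(1)] Pab U by simp
    then have "8 * int (card S) - 4 \<le> 4 * (P * (2 * int m - 1))"
      by (simp add: algebra_simps)
    \<comment> \<open>Now the means of \<open>P\<close> and \<open>2 * m - 1\<close> are compared,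
      for which \<open>base\<close> is enough.\<close>
    moreover have "(P + (2 * int m - 1))\<^sup>2 = 4 * (P * (2 * int m - 1)) + (P - (2 * int m - 1))\<^sup>2"
      by (simp add: power2_eq_square algebra_simps)
    moreover have "0 \<le> (P - (2 * int m - 1))\<^sup>2" by simp
    moreover have "(P + (2 * int m - 1))\<^sup>2 \<le> (bsize S - 2)\<^sup>2"
      using base P1 m1 by (intro power_mono) auto
    ultimately show ?thesis by linarith
  qed
qed

section \<open>Cutting by half-planes and boxes\<close>

text \<open>The removed part, pushed right, lands beyond column \<open>t + 1\<close> and so outside
  the neighbourhood of what remains. It loses nothing and gains one point per column.\<close>

lemma bsize_cut:
  assumes "finite S" "\<not> (\<forall>p\<in>S. fst p \<le> t)"
  shows "bsize {p \<in> S. fst p \<le> t} < bsize S"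
proof -
  let ?A = "{p \<in> S. fst p \<le> t}" and ?B = "{p \<in> S. t < fst p}"
  have fin: "finite ?A" "finite ?B" using assms by auto
  have finN: "finite (shiftR ?B)" using finite_nhd[OF fin(2)] by (simp add: nhd_shift)
  have "nhd ?A \<inter> shiftR ?B = {}" by (auto simp: nhd_def shiftR_def)
  moreover have "nhd ?A \<union> shiftR ?B \<subseteq> nhd S" by (auto simp: nhd_def shiftR_def)
  ultimately have "card (nhd ?A) + card (shiftR ?B) \<le> card (nhd S)"
    using card_mono[OF finite_nhd[OF assms(1)]] card_Un_disjoint fin finN
    by (metis (no_types, lifting) finite_nhd)
  moreover have "card S = card ?A + card ?B"
    using assms(1) by (subst card_Un_disjoint[symmetric]) (auto intro: arg_cong[of _ _ card])
  moreover have "card (fst ` ?B) > 0"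
    using assms fin by (auto simp: card_gt_0_iff not_le)
  ultimately show ?thesis
    using card_shiftR[OF fin(2)] by (simp add: bsize_def)
qed

definition rbox :: "int \<Rightarrow> int \<Rightarrow> int \<Rightarrow> int \<Rightarrow> (int \<times> int) set" where
  "rbox a b c d = {(u, v). a \<le> u \<and> u \<le> b \<and> c \<le> v \<and> v \<le> d \<and> even (u + v)}"

text \<open>Every side of the box contains a point of even coordinate sum.\<close>

definition tight :: "int \<Rightarrow> int \<Rightarrow> int \<Rightarrow> int \<Rightarrow> bool" where
  "tight a b c d \<longleftrightarrow> a \<le> b \<and> c \<le> d \<and> (a = b \<longrightarrow> even (a + c) \<and> even (a + d))
     \<and> (c = d \<longrightarrow> even (a + c) \<and> even (b + c))"

definition evens :: "(int \<times> int) set" where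
  "evens = {(u, v). even (u + v)}"

lemma mem_rbox [simp]:
  "(u, v) \<in> rbox a b c d \<longleftrightarrow> a \<le> u \<and> u \<le> b \<and> c \<le> v \<and> v \<le> d \<and> even (u + v)"
  by (simp add: rbox_def)

lemma mem_evens [simp]: "(u, v) \<in> evens \<longleftrightarrow> even (u + v)"
  by (simp add: evens_def)

lemma rbox_evens: "rbox a b c d \<subseteq> evens"
  by auto

lemma finite_rbox [simp]: "finite (rbox a b c d)"
  by (rule finite_subset[of _ "{a..b} \<times> {c..d}"]) auto

lemma rbox_reflect: "reflect (rbox a b c d) = rbox (- b) (- a) c d"
  by auto

lemma rbox_swap_uv: "swap_uv (rbox a b c d) = rbox c d a b"
  by (auto simp: add.commute)

lemma tight_reflect: "tight (- b) (- a) c d \<longleftrightarrow> tight a b c d"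
  unfolding tight_def by auto

lemma tight_swap_uv: "tight c d a b \<longleftrightarrow> tight a b c d"
  unfolding tight_def by (auto simp: add.commute)

lemma reflect_reflect [simp]: "reflect (reflect S) = S"
  by (simp add: reflect_def)

lemma swap_uv_swap_uv [simp]: "swap_uv (swap_uv S) = S"
  by (simp add: swap_uv_def)

lemma reflect_mono [simp]: "reflect S \<subseteq> reflect T \<longleftrightarrow> S \<subseteq> T"
  by (metis (no_types, lifting) image_mono reflect_image reflect_reflect)

lemma swap_uv_mono [simp]: "swap_uv S \<subseteq> swap_uv T \<longleftrightarrow> S \<subseteq> T"
  by (metis (no_types, lifting) image_mono swap_uv_image swap_uv_swap_uv)

lemma bsize_cut_ge:
  assumes "finite S" "\<not> (\<forall>p\<in>S. t \<le> fst p)"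
  shows "bsize {p \<in> S. t \<le> fst p} < bsize S"
proof -
  have "{p \<in> S. t \<le> fst p} = reflect {p \<in> reflect S. fst p \<le> - t}"
    by (auto simp: reflect_def)
  moreover have "\<not> (\<forall>p\<in>reflect S. fst p \<le> - t)"
    using assms(2) by (force simp: reflect_image)
  ultimately show ?thesis using bsize_cut[of "reflect S" "- t"] assms by simp
qed

lemma bsize_strip:
  assumes "finite S"
  shows "bsize {p \<in> S. a \<le> fst p \<and> fst p \<le> b} \<le> bsize S"
    and "\<not> (\<forall>p\<in>S. a \<le> fst p \<and> fst p \<le> b) \<Longrightarrow> bsize {p \<in> S. a \<le> fst p \<and> fst p \<le> b} < bsize S"
proof -
  let ?T = "{p \<in> S. fst p \<le> b}"
  have eq: "{p \<in> S. a \<le> fst p \<and> fst p \<le> b} = {p \<in> ?T. a \<le> fst p}" by auto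
  have 1: "bsize ?T \<le> bsize S \<and> (?T = S \<or> bsize ?T < bsize S)"
  proof (cases "\<forall>p\<in>S. fst p \<le> b")
    case True
    then have "?T = S" by blast
    then show ?thesis by simp
  qed (use bsize_cut[OF assms, of b] in simp)
  have 2: "bsize {p \<in> ?T. a \<le> fst p} \<le> bsize ?T \<and> ({p \<in> ?T. a \<le> fst p} = ?T \<or> bsize {p \<in> ?T. a \<le> fst p} < bsize ?T)"
  proof (cases "\<forall>p\<in>?T. a \<le> fst p")
    case True
    then have "{p \<in> ?T. a \<le> fst p} = ?T" by blast
    then show ?thesis by simp
  qed (use bsize_cut_ge[of ?T a] assms in auto)
  show "bsize {p \<in> S. a \<le> fst p \<and> fst p \<le> b} \<le> bsize S"
    unfolding eq using 1 2 by linarith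
  show "bsize {p \<in> S. a \<le> fst p \<and> fst p \<le> b} < bsize S"
    if neg: "\<not> (\<forall>p\<in>S. a \<le> fst p \<and> fst p \<le> b)"
  proof -
    have "\<not> ({p \<in> ?T. a \<le> fst p} = ?T \<and> ?T = S)" using neg by blast
    then show ?thesis unfolding eq using 1 2 by linarith
  qed
qed

text \<open>The box is cut out as a strip in each coordinate, the second one after
  \<open>swap_uv\<close>; a strip that really removes points gives the strict inequality.\<close>

lemma bsize_Int_rbox:
  assumes "finite S" "S \<subseteq> evens" "\<not> S \<subseteq> rbox a b c d"
  shows "bsize (S \<inter> rbox a b c d) < bsize S"
proof -
  let ?T = "{p \<in> S. a \<le> fst p \<and> fst p \<le> b}"
  let ?W = "{p \<in> swap_uv ?T. c \<le> fst p \<and> fst p \<le> d}"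
  have eq: "S \<inter> rbox a b c d = swap_uv ?W"
    using assms(2) by auto
  have fin: "finite (swap_uv ?T)" using assms by simp
  show ?thesis
  proof (cases "\<forall>p\<in>S. a \<le> fst p \<and> fst p \<le> b")
    case False
    then show ?thesis
      using bsize_strip(2)[OF assms(1) False] bsize_strip(1)[OF fin, of c d] unfolding eq by simp
  next
    case True
    then have T: "?T = S" by blast
    have "\<not> (\<forall>p\<in>swap_uv ?T. c \<le> fst p \<and> fst p \<le> d)"
    proof
      assume *: "\<forall>p\<in>swap_uv ?T. c \<le> fst p \<and> fst p \<le> d"
      have "(u, v) \<in> rbox a b c d" if "(u, v) \<in> S" for u v
      proof -
        have "(v, u) \<in> swap_uv ?T" using that True by force
        then have "c \<le> v \<and> v \<le> d" using * by fastforce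
        then show ?thesis using that True assms(2) by fastforce
      qed
      then show False using assms(3) by auto
    qed
    then show ?thesis
      using bsize_strip(2)[OF fin, of c d] unfolding eq using T by simp
  qed
qed

section \<open>Sets to which no point can be added for free\<close>

definition filled :: "(int \<times> int) set \<Rightarrow> bool" where
  "filled S \<longleftrightarrow> (\<forall>x\<in>evens. bsize (insert x S) \<le> bsize S \<longrightarrow> x \<in> S)"

lemma insert_symmetries:
  "reflect (insert (u, v) S) = insert (- u, v) (reflect S)"
  "swap_uv (insert (u, v) S) = insert (v, u) (swap_uv S)"
  by (auto simp: reflect_def swap_uv_def)

lemma filled_reflect: "filled S \<Longrightarrow> filled (reflect S)"
  unfolding filled_def
proof (clarify)
  fix u v
  assume *: "\<forall>x\<in>evens. bsize (insert x S) \<le> bsize S \<longrightarrow> x \<in> S"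
    and "(u, v) \<in> evens" "bsize (insert (u, v) (reflect S)) \<le> bsize (reflect S)"
  then have "(- u, v) \<in> evens" "bsize (insert (- u, v) S) \<le> bsize S"
    using insert_symmetries(1)[of "- u" v S] bsize_reflect[of "insert (- u, v) S"] by auto
  then show "(u, v) \<in> reflect S" using * by simp
qed

lemma filled_swap_uv: "filled S \<Longrightarrow> filled (swap_uv S)"
  unfolding filled_def
proof (clarify)
  fix u v
  assume *: "\<forall>x\<in>evens. bsize (insert x S) \<le> bsize S \<longrightarrow> x \<in> S"
    and "(u, v) \<in> evens" "bsize (insert (u, v) (swap_uv S)) \<le> bsize (swap_uv S)"
  then have "(v, u) \<in> evens" "bsize (insert (v, u) S) \<le> bsize S"
    using insert_symmetries(2)[of v u S] bsize_swap_uv[of "insert (v, u) S"] by (auto simp: add.commute)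
  then show "(u, v) \<in> swap_uv S" using * by simp
qed

text \<open>\<open>ws\<close> lists the possible new points of the neighbourhood; the
  \<open>- 1\<close> is \<open>x\<close>, which now counts as a member.\<close>

lemma bsize_insert_le:
  assumes "finite S" "x \<notin> S" "nhd (insert x S) \<subseteq> nhd S \<union> set ws"
  shows "bsize (insert x S) \<le> bsize S + int (length ws) - 1"
proof -
  have "card (nhd (insert x S)) \<le> card (nhd S) + card (set ws)"
    using card_mono[OF _ assms(3)] card_Un_le[of "nhd S" "set ws"] assms(1) by simp
  then show ?thesis using card_length[of ws] assms(1,2) by (simp add: bsize_def)
qed

text \<open>If three of the four neighbours of a neighbourhood point are already in
  \<open>nhd S\<close>, adding it creates at most one new point, so it is free. The signs
  \<open>r\<close> and \<open>s\<close> name the fourth direction.\<close>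

lemma filledD:
  assumes "finite S" "filled S" "(u, v) \<in> nhd S" "even (u + v)" "r \<in> {-1, 1}" "s \<in> {-1, 1}"
    and "(u + r, v - s) \<in> nhd S" "(u - r, v + s) \<in> nhd S" "(u - r, v - s) \<in> nhd S"
  shows "(u, v) \<in> S"
proof (rule ccontr)
  assume neg: "(u, v) \<notin> S"
  have "nhd (insert (u, v) S) = nhd S \<union> nhd {(u, v)}" using nhd_Un[of S "{(u, v)}"] by simp
  also have "nhd {(u, v)} = {(u, v), (u + 1, v + 1), (u + 1, v - 1), (u - 1, v + 1), (u - 1, v - 1)}"
    by (auto simp: nhd_def)
  finally have "nhd (insert (u, v) S) \<subseteq> nhd S \<union> set [(u + r, v + s)]"
    using assms(3,5-9) by auto
  then have "bsize (insert (u, v) S) \<le> bsize S"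
    using bsize_insert_le[OF assms(1) neg] by fastforce
  then show False using assms(2,4) neg by (auto simp: filled_def)
qed

lemma nhdI: "(u, v) \<in> S \<Longrightarrow> r \<in> {-1, 1} \<Longrightarrow> s \<in> {-1, 1} \<Longrightarrow> (u + r, v + s) \<in> nhd S"
  by (auto simp: nhd_def)

lemma nhd_rbox:
  assumes "tight a b c d"
  shows "nhd (rbox a b c d) = rbox (a - 1) (b + 1) (c - 1) (d + 1)"
proof
  show "nhd (rbox a b c d) \<subseteq> rbox (a - 1) (b + 1) (c - 1) (d + 1)"
    by (auto simp: nhd_def)
  show "rbox (a - 1) (b + 1) (c - 1) (d + 1) \<subseteq> nhd (rbox a b c d)"
  proof clarify
    fix u v assume uv: "(u, v) \<in> rbox (a - 1) (b + 1) (c - 1) (d + 1)"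
    then have e: "even (u + v)" by simp
    \<comment> \<open>Both steps lead towards the box, or stay in range if the coordinate is already
      there. If the range is a single value, tightness excludes such a point by parity.\<close>
    define r where "r = (if u < a then 1 else if u > b then -1 else if u < b then 1 else (-1::int))"
    define s where "s = (if v < c then 1 else if v > d then -1 else if v < d then 1 else (-1::int))"
    show "(u, v) \<in> nhd (rbox a b c d)"
    proof (cases "(u, v) \<in> rbox a b c d")
      case True then show ?thesis using subset_nhd by blast
    next
      case False
      have "(u + r, v + s) \<in> rbox a b c d"
        using uv False assms e unfolding r_def s_def tight_def by (simp split: if_splits) presburger+
      moreover have "r = 1 \<or> r = -1" "s = 1 \<or> s = -1" by (auto simp: r_def s_def)
      ultimately show ?thesis by (auto simp: nhd_def simp del: mem_rbox)
    qed
  qed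
qed

section \<open>Enlarging a box inside a filled set\<close>

definition hosts :: "(int \<times> int) set \<Rightarrow> int \<Rightarrow> int \<Rightarrow> int \<Rightarrow> int \<Rightarrow> bool" where
  "hosts S a b c d \<longleftrightarrow> finite S \<and> filled S \<and> S \<subseteq> evens \<and> tight a b c d \<and> rbox a b c d \<subseteq> S"

definition enlargeable :: "(int \<times> int) set \<Rightarrow> int \<Rightarrow> int \<Rightarrow> int \<Rightarrow> int \<Rightarrow> bool" where
  "enlargeable S a b c d \<longleftrightarrow> (\<exists>a' b' c' d'. tight a' b' c' d' \<and> rbox a b c d \<subset> rbox a' b' c' d'
     \<and> rbox a' b' c' d' \<subseteq> S)"

lemma evens_reflect: "reflect evens = evens" and evens_swap_uv: "swap_uv evens = evens"
  by (auto simp: reflect_def swap_uv_def evens_def add.commute)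

lemma hosts_reflect: "hosts S a b c d \<Longrightarrow> hosts (reflect S) (- b) (- a) c d"
  unfolding hosts_def
  by (metis evens_reflect filled_reflect finite_reflect rbox_reflect reflect_mono tight_reflect)

lemma hosts_swap_uv: "hosts S a b c d \<Longrightarrow> hosts (swap_uv S) c d a b"
  unfolding hosts_def
  by (metis evens_swap_uv filled_swap_uv finite_swap_uv rbox_swap_uv swap_uv_mono tight_swap_uv)

lemma enlargeable_reflect: "enlargeable (reflect S) (- b) (- a) c d \<Longrightarrow> enlargeable S a b c d"
  unfolding enlargeable_def
  by (metis minus_minus psubset_eq rbox_reflect reflect_mono reflect_reflect tight_reflect)

lemma enlargeable_swap_uv: "enlargeable (swap_uv S) c d a b \<Longrightarrow> enlargeable S a b c d"
  unfolding enlargeable_def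
  by (metis psubset_eq rbox_swap_uv swap_uv_mono swap_uv_swap_uv tight_swap_uv)

lemma hosts_nhd:
  assumes "hosts S a b c d" "a - 1 \<le> u" "u \<le> b + 1" "c - 1 \<le> v" "v \<le> d + 1" "even (u + v)"
  shows "(u, v) \<in> nhd S"
  using assms nhd_rbox[of a b c d] nhd_mono[of "rbox a b c d" S] unfolding hosts_def by auto

text \<open>A single point beside the right side fills the whole column \<open>b + 1\<close> by
  steps of two: the two left neighbours of the next point belong to the neighbourhood of the box,
  and one right neighbour is shared with the previous point.\<close>

lemma enlargeable_right:
  assumes h: "hosts S a b c d" and "(b + 1, v) \<in> S" "c \<le> v" "v \<le> d"
  shows "enlargeable S a b c d"
proof -
  note N = hosts_nhd[OF h]
  have fin: "finite S" "filled S" and ab: "a \<le> b" "tight a b c d"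
    using h by (auto simp: hosts_def tight_def)
  have ev: "even (b + 1 + v)" using h assms(2) unfolding hosts_def by fastforce
  have up: "(b + 1, v + 2 * int i) \<in> S" if "v + 2 * int i \<le> d" for i
    using that
  proof (induction i)
    case 0 then show ?case using assms by simp
  next
    case (Suc i)
    then have "(b + 1, v + 2 * int i) \<in> S" by simp
    then have "(b + 1 + 1, v + 2 * int i + 1) \<in> nhd S" by (rule nhdI) auto
    then show ?case
      using Suc.prems assms ev ab
      by (intro filledD[OF fin, where r = 1 and s = 1]) (auto simp: algebra_simps intro: N)
  qed
  have down: "(b + 1, v - 2 * int i) \<in> S" if "c \<le> v - 2 * int i" for i
    using that
  proof (induction i)
    case 0 then show ?case using assms by simp
  next
    case (Suc i)
    then have "(b + 1, v - 2 * int i) \<in> S" by simp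
    then have "(b + 1 + 1, v - 2 * int i + (- 1)) \<in> nhd S" by (rule nhdI) auto
    then show ?case
      using Suc.prems assms ev ab
      by (intro filledD[OF fin, where r = 1 and s = "- 1"]) (auto simp: algebra_simps intro: N)
  qed
  have line: "(b + 1, w) \<in> S" if "c \<le> w" "w \<le> d" "even (b + 1 + w)" for w
  proof -
    have "even (w - v)" using that ev by presburger
    then obtain k where k: "w = v + 2 * k" by (metis add.commute diff_add_cancel dvdE)
    show ?thesis
    proof (cases "k \<ge> 0")
      case True then show ?thesis using up[of "nat k"] k that by simp
    next
      case False then show ?thesis using down[of "nat (- k)"] k that by simp
    qed
  qed
  have "rbox a (b + 1) c d \<subseteq> S"
  proof clarify
    fix u w assume uw: "(u, w) \<in> rbox a (b + 1) c d"
    show "(u, w) \<in> S"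
    proof (cases "u = b + 1")
      case True then show ?thesis using line uw by auto
    next
      case False
      then have "(u, w) \<in> rbox a b c d" using uw by auto
      then show ?thesis using h by (auto simp: hosts_def)
    qed
  qed
  moreover have "tight a (b + 1) c d"
    using ab(2) ev assms unfolding tight_def by auto
  moreover have "rbox a b c d \<subset> rbox a (b + 1) c d"
  proof
    show "rbox a b c d \<subseteq> rbox a (b + 1) c d" by auto
    have "(b + 1, v) \<in> rbox a (b + 1) c d" "(b + 1, v) \<notin> rbox a b c d"
      using assms ev ab by auto
    then show "rbox a b c d \<noteq> rbox a (b + 1) c d" by metis
  qed
  ultimately show ?thesis unfolding enlargeable_def by blast
qed

lemma enlargeable_top:
  assumes "hosts S a b c d" "(u, d + 1) \<in> S" "a \<le> u" "u \<le> b"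
  shows "enlargeable S a b c d"
  using enlargeable_right[OF hosts_swap_uv[OF assms(1)], of u] assms enlargeable_swap_uv by simp

text \<open>A common point \<open>w\<close> of the neighbourhoods leaves six positions for
  \<open>(u, v)\<close>. In five of them \<open>filledD\<close> yields a point beside the box, or a
  degenerate box grows directly; only the diagonal position at distance two resists.\<close>

lemma enlargeable_NE:
  assumes h: "hosts S a b c d" and uv: "(u, v) \<in> S" "b < u" "c \<le> v"
    and w: "w \<in> nhd {(u, v)}" "w \<in> nhd (rbox a b c d)"
  shows "enlargeable S a b c d \<or> (u = b + 2 \<and> v = d + 2 \<and> w = (b + 1, d + 1))"
proof -
  note N = hosts_nhd[OF h]
  have fin: "finite S" "filled S" and t: "tight a b c d" and ab: "a \<le> b" "c \<le> d"
    using h by (auto simp: hosts_def tight_def)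
  have ev: "even (u + v)" using h uv unfolding hosts_def by fastforce
  have SN: "(u, v) \<in> nhd S" using uv(1) subset_nhd by blast
  have Ns: "(u + r, v + s) \<in> nhd S" if "r \<in> {-1, 1}" "s \<in> {-1, 1}" for r s
    using nhdI[OF uv(1) that] .
  note Ns1 = SN Ns[of 1 1, simplified] Ns[of 1 "-1", simplified] Ns[of "-1" 1, simplified] Ns[of "-1" "-1", simplified]
  obtain w1 w2 where w12: "w = (w1, w2)" by (cases w)
  have wu: "w1 - u \<in> {-1, 0, 1} \<and> w2 - v \<in> {-1, 0, 1}"
    using w(1) w12 by (auto simp: nhd_def)
  have wb: "w1 \<le> b + 1" "w2 \<le> d + 1" using w(2) w12 nhd_rbox[OF t] by auto
  have ub: "u \<le> b + 2" "v \<le> d + 2" using wu wb by auto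
  consider "u = b + 1" "v \<le> d" | "u = b + 1" "v = d + 1" | "u = b + 1" "v = d + 2"
    | "u = b + 2" "v \<le> d" | "u = b + 2" "v = d + 1" | "u = b + 2" "v = d + 2"
    using ub uv(2) by linarith
  then show ?thesis
  proof cases
    case 1 then show ?thesis using enlargeable_right[OF h] uv by auto
  next
    case 2
    consider "c < d" | "c = d" "a < b" | "c = d" "a = b" using ab by linarith
    then show ?thesis
    proof cases
      case 1
      have "(b + 1, d - 1) \<in> S"
        using 1 2 ab ev Ns1 by (intro filledD[OF fin, where r = 1 and s = "- 1"]) (auto simp: algebra_simps intro: N)
      then show ?thesis using enlargeable_right[OF h, of "d - 1"] 1 by auto
    next
      case 2
      have "(b - 1, d + 1) \<in> S"
        using 2 \<open>u = b + 1\<close> \<open>v = d + 1\<close> ab ev Ns1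
        by (intro filledD[OF fin, where r = "- 1" and s = 1]) (auto simp: algebra_simps intro: N)
      then show ?thesis using enlargeable_top[OF h, of "b - 1"] 2 by auto
    next
      \<comment> \<open>A point and its diagonal neighbour already form a tight box, because the
        other two corners have odd coordinate sum.\<close>
      case 3
      then have "(a, c) \<in> S" using h t by (auto simp: hosts_def tight_def)
      have "rbox a b c d = {(a, c)}" using 3 t by (auto simp: tight_def)
      moreover have "rbox a (b + 1) c (d + 1) = {(a, c), (b + 1, d + 1)}"
        using 3 t by (auto simp: tight_def; presburger)
      moreover have "tight a (b + 1) c (d + 1)" using ab by (auto simp: tight_def)
      moreover have "{(a, c), (b + 1, d + 1)} \<subseteq> S"
        using \<open>(a, c) \<in> S\<close> uv(1) \<open>u = b + 1\<close> \<open>v = d + 1\<close> by simp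
      moreover have "{(a, c)} \<subset> {(a, c), (b + 1, d + 1)}" using 3 by auto
      ultimately show ?thesis unfolding enlargeable_def by metis
    qed
  next
    case 3
    then have "a \<noteq> b" "c \<noteq> d" using t ev unfolding tight_def by auto
    then have "(b, d + 1) \<in> S"
      using 3 ab ev Ns1 by (intro filledD[OF fin, where r = "- 1" and s = 1]) (auto simp: algebra_simps intro: N)
    then show ?thesis using enlargeable_top[OF h, of b] ab by auto
  next
    case 4
    consider "v < d" | "c < v" | "v = c" "v = d" using uv(3) 4 by linarith
    then show ?thesis
    proof cases
      case 1
      have "(b + 1, v + 1) \<in> S"
        using 1 4 ab ev Ns1 uv by (intro filledD[OF fin, where r = 1 and s = 1]) (auto simp: algebra_simps intro: N)
      then show ?thesis using enlargeable_right[OF h, of "v + 1"] 1 uv by auto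
    next
      case 2
      have "(b + 1, v - 1) \<in> S"
        using 2 4 ab ev Ns1 uv by (intro filledD[OF fin, where r = 1 and s = "- 1"]) (auto simp: algebra_simps intro: N)
      then show ?thesis using enlargeable_right[OF h, of "v - 1"] 2 4 uv by auto
    next
      \<comment> \<open>A tight box of one row has a point at every second coordinate, so
        \<open>(u, v)\<close> just prolongs the row.\<close>
      case 3
      then have e: "even (a + c)" "even (b + c)" using t by (auto simp: tight_def)
      have eq: "rbox a (b + 2) c d = insert (u, v) (rbox a b c d)"
        using 3 4 ab ev e by (auto; presburger)
      moreover have "tight a (b + 2) c d" using 3 e ab by (auto simp: tight_def)
      moreover have "(u, v) \<notin> rbox a b c d" using uv by simp
      moreover have "insert (u, v) (rbox a b c d) \<subseteq> S" using h uv by (auto simp: hosts_def)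
      ultimately show ?thesis unfolding enlargeable_def by (metis psubset_insert_iff subset_insertI insertI1 psubsetI)
    qed
  next
    case 5
    then have "a \<noteq> b" "c \<noteq> d" using t ev unfolding tight_def by auto
    then have "(b + 1, d) \<in> S"
      using 5 ab ev Ns1 by (intro filledD[OF fin, where r = 1 and s = "- 1"]) (auto simp: algebra_simps intro: N)
    then show ?thesis using enlargeable_right[OF h, of d] ab by auto
  next
    case 6
    then have "w = (b + 1, d + 1)" using wu wb w12 by auto
    then show ?thesis using 6 by simp
  qed
qed

lemma nhd_point_reflect: "nhd {(- u, v)} = reflect (nhd {(u, v)})"
  by (auto simp: nhd_def)

lemma nhd_point_swap_uv: "nhd {(v, u)} = swap_uv (nhd {(u, v)})"
  by (auto simp: nhd_def)

lemma enlargeable_NW: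
  assumes h: "hosts S a b c d" and uv: "(u, v) \<in> S" "u < a" "c \<le> v"
    and w: "(w1, w2) \<in> nhd {(u, v)}" "(w1, w2) \<in> nhd (rbox a b c d)"
  shows "enlargeable S a b c d \<or> (u = a - 2 \<and> v = d + 2 \<and> (w1, w2) = (a - 1, d + 1))"
proof -
  have "enlargeable (reflect S) (- b) (- a) c d \<or> (- u = - a + 2 \<and> v = d + 2 \<and> (- w1, w2) = (- a + 1, d + 1))"
    using uv w
    by (intro enlargeable_NE[OF hosts_reflect[OF h]])
      (simp_all add: nhd_point_reflect nhd_reflect flip: rbox_reflect)
  then show ?thesis using enlargeable_reflect by auto
qed

lemma enlargeable_SW:
  assumes h: "hosts S a b c d" and uv: "(u, v) \<in> S" "u < a" "v \<le> d"
    and w: "(w1, w2) \<in> nhd {(u, v)}" "(w1, w2) \<in> nhd (rbox a b c d)"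
  shows "enlargeable S a b c d \<or> (u = a - 2 \<and> v = c - 2 \<and> (w1, w2) = (a - 1, c - 1))"
proof -
  let ?T = "swap_uv (reflect (swap_uv S))"
  have h': "hosts ?T a b (- d) (- c)" by (intro hosts_swap_uv hosts_reflect h)
  have eq: "rbox a b (- d) (- c) = swap_uv (reflect (swap_uv (rbox a b c d)))"
    by (simp add: rbox_swap_uv rbox_reflect)
  have eq2: "nhd {(u, - v)} = swap_uv (reflect (swap_uv (nhd {(u, v)})))"
    by (auto simp: nhd_def)
  have "enlargeable ?T a b (- d) (- c) \<or> (u = a - 2 \<and> - v = - c + 2 \<and> (w1, - w2) = (a - 1, - c + 1))"
    using uv w
    by (intro enlargeable_NW[OF h']) (simp_all add: eq eq2 nhd_reflect nhd_swap_uv del: mem_rbox)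
  moreover have "enlargeable S a b c d" if "enlargeable ?T a b (- d) (- c)"
    by (rule enlargeable_swap_uv[OF enlargeable_reflect[OF enlargeable_swap_uv[OF that]]])
  ultimately show ?thesis by auto
qed

text \<open>Points above and below the box are handled by \<open>swap_uv\<close>. The exceptional
  positions at the right corners lie in column \<open>b + 2\<close> and are excluded by
  \<open>u \<le> b\<close>.\<close>

lemma enlargeable_left_corner:
  assumes h: "hosts S a b c d" and uv: "(u, v) \<in> S" "(u, v) \<notin> rbox a b c d" "u \<le> b"
    and w: "(w1, w2) \<in> nhd {(u, v)}" "(w1, w2) \<in> nhd (rbox a b c d)"
  shows "enlargeable S a b c d \<or> (u = a - 2 \<and> v = d + 2 \<and> (w1, w2) = (a - 1, d + 1))
    \<or> (u = a - 2 \<and> v = c - 2 \<and> (w1, w2) = (a - 1, c - 1))"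
proof -
  have ev: "even (u + v)" using h uv unfolding hosts_def by fastforce
  consider "u < a" "c \<le> v" | "u < a" "v < c" | "a \<le> u" "d < v" | "a \<le> u" "v < c"
    using uv ev by fastforce
  then show ?thesis
  proof cases
    case 1 then show ?thesis using enlargeable_NW[OF h uv(1) _ _ w] by blast
  next
    case 2
    moreover have "c \<le> d" using h by (simp add: hosts_def tight_def)
    ultimately show ?thesis using enlargeable_SW[OF h uv(1) _ _ w] by auto
  next
    case 3
    have "enlargeable (swap_uv S) c d a b \<or> (v = d + 2 \<and> u = b + 2 \<and> (w2, w1) = (d + 1, b + 1))"
      using uv w 3
      by (intro enlargeable_NE[OF hosts_swap_uv[OF h]])
        (simp_all add: nhd_point_swap_uv[of v u] nhd_swap_uv rbox_swap_uv[of a b c d, symmetric] del: mem_rbox)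
    then show ?thesis using enlargeable_swap_uv uv(3) by auto
  next
    case 4
    have "enlargeable (swap_uv S) c d a b \<or> (v = c - 2 \<and> u = b + 2 \<and> (w2, w1) = (c - 1, b + 1))"
      using uv w 4
      by (intro enlargeable_NW[OF hosts_swap_uv[OF h]])
        (simp_all add: nhd_point_swap_uv[of v u] nhd_swap_uv rbox_swap_uv[of a b c d, symmetric] del: mem_rbox)
    then show ?thesis using enlargeable_swap_uv uv(3) by auto
  qed
qed

section \<open>Optimal sets and their completion to boxes\<close>

text \<open>Numerical form of minimality; the equivalence is \<open>minimal_iff_optimal\<close>.\<close>

definition optimal :: "(int \<times> int) set \<Rightarrow> bool" where
  "optimal S \<longleftrightarrow> finite S \<and> S \<noteq> {} \<and> S \<subseteq> evens \<and> (bsize S - 3)\<^sup>2 < 8 * int (card S) - 4"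

lemma tight_right_side: "tight a b c d \<Longrightarrow> \<exists>v. (b, v) \<in> rbox a b c d"
  by (cases "even (b + c)"; cases "c < d"; auto simp: tight_def intro: exI[of _ c] exI[of _ "c + 1"])

text \<open>Touching the last column \<open>b\<close> leaves only two exceptional positions for the
  rest \<open>R\<close>, so \<open>E\<close> and \<open>R\<close> share few boundary points. Being
  apart is then too costly for an optimal set.\<close>

lemma filled_optimal_eq_rbox:
  assumes "optimal S" "filled S"
  shows "\<exists>a b c d. tight a b c d \<and> S = rbox a b c d"
proof -
  have S: "finite S" "S \<noteq> {}" "S \<subseteq> evens" and opt: "(bsize S - 3)\<^sup>2 < 8 * int (card S) - 4"
    using assms by (auto simp: optimal_def)
  define b where "b = Max (fst ` S)"
  have "b \<in> fst ` S" unfolding b_def using S by (intro Max_in) auto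
  then obtain z where z: "(b, z) \<in> S" by auto
  have b_max: "u \<le> b" if "(u, v) \<in> S" for u v
    unfolding b_def using S(1) that by (intro Max_ge) force+
  \<comment> \<open>Sizes of the tight boxes in \<open>S\<close> whose right side lies in the last
    column; the one-point box at \<open>z\<close> shows that there are some.\<close>
  define K where "K k \<longleftrightarrow> (\<exists>a c d. tight a b c d \<and> rbox a b c d \<subseteq> S \<and> k = card (rbox a b c d))" for k
  have evz: "even (b + z)" using z S(3) by fastforce
  have "rbox b b z z \<subseteq> S" using z by auto
  then have "K (card (rbox b b z z))" using evz unfolding K_def tight_def by blast
  moreover have "\<forall>k. K k \<longrightarrow> k \<le> card S"
    using card_mono[OF S(1)] by (auto simp: K_def)
  ultimately obtain k where k: "K k" "\<And>k'. K k' \<Longrightarrow> k' \<le> k"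
    using Nat.ex_has_greatest_nat[of K] by metis
  then obtain a c d where t: "tight a b c d" and ES: "rbox a b c d \<subseteq> S" and kE: "k = card (rbox a b c d)"
    by (auto simp: K_def)
  define E where "E = rbox a b c d"
  have h: "hosts S a b c d" using S assms(2) t ES by (simp add: hosts_def)
  have not_enl: "\<not> enlargeable S a b c d"
  proof
    assume "enlargeable S a b c d"
    then obtain a' b' c' d' where t': "tight a' b' c' d'" and ps: "rbox a b c d \<subset> rbox a' b' c' d'"
      and s': "rbox a' b' c' d' \<subseteq> S" unfolding enlargeable_def by blast
    \<comment> \<open>An enlarged box still reaches column \<open>b\<close> and cannot pass it, so
      it competes with \<open>k\<close>.\<close>
    have "b' \<le> b" using tight_right_side[OF t'] s' b_max by blast
    moreover have "b \<le> b'" using tight_right_side[OF t] psubset_imp_subset[OF ps] mem_rbox by blast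
    ultimately have "b' = b" by simp
    then have "K (card (rbox a' b' c' d'))" using t' s' unfolding K_def by blast
    then show False using k(2) kE psubset_card_mono[OF _ ps] by force
  qed
  define R where "R = S - E"
  have "R = {}"
  proof (rule ccontr)
    assume ne: "R \<noteq> {}"
    have finR: "finite R" and finE: "finite E" using S by (auto simp: R_def E_def)
    have Ene: "E \<noteq> {}" unfolding E_def using tight_right_side[OF t] by blast
    have SER: "S = E \<union> R" "E \<inter> R = {}" using ES by (auto simp: R_def E_def)
    \<comment> \<open>\<open>?X\<close> holds the exceptional points; \<open>?g\<close> maps each to
      the only neighbourhood point it shares with \<open>E\<close>.\<close>
    let ?X = "R \<inter> {(a - 2, d + 2), (a - 2, c - 2)}"
    let ?g = "\<lambda>(u, v). (u + 1, if v = d + 2 then d + 1 else c - 1)"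
    have cd: "c \<le> d" using t by (simp add: tight_def)
    have "nhd E \<inter> nhd R \<subseteq> ?g ` ?X"
    proof clarify
      fix w1 w2 assume w: "(w1, w2) \<in> nhd E" "(w1, w2) \<in> nhd R"
      then obtain u v where uv: "(u, v) \<in> R" "(w1, w2) \<in> nhd {(u, v)}"
        by (auto simp: nhd_def)
      then have uvS: "(u, v) \<in> S" "(u, v) \<notin> rbox a b c d" by (auto simp: R_def E_def)
      have "(u = a - 2 \<and> v = d + 2 \<and> (w1, w2) = (a - 1, d + 1))
        \<or> (u = a - 2 \<and> v = c - 2 \<and> (w1, w2) = (a - 1, c - 1))"
        using enlargeable_left_corner[OF h uvS b_max[OF uvS(1)] uv(2)] w(1) not_enl E_def by auto
      then show "(w1, w2) \<in> ?g ` ?X"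
        using uv(1) cd by (intro image_eqI[of _ _ "(u, v)"]) auto
    qed
    then have "card (nhd E \<inter> nhd R) \<le> card ?X"
      using surj_card_le[of ?X] by auto
    moreover have "card ?X \<le> card R" using finR by (intro card_mono) auto
    moreover have "card ?X \<le> 2"
      by (rule order.trans[OF card_mono[of "{(a - 2, d + 2), (a - 2, c - 2)}"]]) (auto simp: card_insert_if)
    ultimately have j: "card (nhd E \<inter> nhd R) \<le> card R" "card (nhd E \<inter> nhd R) \<le> 2" by auto
    \<comment> \<open>Shifted by 2 to make the isoperimetric inequality a bound on \<alpha> and
      \<beta> squared.\<close>
    define \<alpha> \<beta> where "\<alpha> = bsize E - 2" and "\<beta> = bsize R - 2"
    have bS: "bsize S = \<alpha> + \<beta> + 4 - int (card (nhd E \<inter> nhd R))"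
    proof -
      have "card (nhd E) + card (nhd R) = card (nhd S) + card (nhd E \<inter> nhd R)"
        using card_Un_Int[of "nhd E" "nhd R"] finE finR by (simp add: SER(1) nhd_Un)
      moreover have "card S = card E + card R"
        using card_Un_disjoint[OF finE finR SER(2)] SER(1) by simp
      ultimately show ?thesis unfolding bsize_def \<alpha>_def \<beta>_def by simp
    qed
    have cS: "card S = card E + card R"
      using card_Un_disjoint[OF finE finR SER(2)] SER(1) by simp
    have al: "\<alpha> \<ge> 2" "\<alpha>\<^sup>2 \<ge> 8 * int (card E) - 4"
      using isoperimetric[OF finE Ene] by (auto simp: \<alpha>_def)
    have be: "\<beta> \<ge> 2" "\<beta>\<^sup>2 \<ge> 8 * int (card R) - 4"
      using isoperimetric[OF finR ne] by (auto simp: \<beta>_def)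
    have sq: "(\<alpha> + \<beta> + 1 - int (card (nhd E \<inter> nhd R)))\<^sup>2 < \<alpha>\<^sup>2 + \<beta>\<^sup>2 + 4"
      using opt al(2) be(2) cS bS by (simp add: algebra_simps)
    \<comment> \<open>A single point shares at most one neighbourhood point. With two or more points
      in \<open>R\<close>, two may be shared, but then \<beta> \<ge> 4 compensates.\<close>
    have "card R = 1 \<or> card R \<ge> 2" using finR ne card_gt_0_iff[of R] by linarith
    then show False
    proof
      assume "card R = 1"
      then have "(\<alpha> + \<beta>)\<^sup>2 \<le> (\<alpha> + \<beta> + 1 - int (card (nhd E \<inter> nhd R)))\<^sup>2"
        using j(1) al(1) be(1) by (intro power_mono) auto
      moreover have "2 * 2 \<le> \<alpha> * \<beta>" using al(1) be(1) by (intro mult_mono) auto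
      ultimately show False using sq by (simp add: power2_sum)
    next
      assume R2: "card R \<ge> 2"
      have "\<beta> \<ge> 4"
      proof (rule ccontr)
        assume "\<not> \<beta> \<ge> 4"
        then have "\<beta>\<^sup>2 \<le> 3\<^sup>2" using be(1) by (intro power_mono) auto
        then show False using be(2) R2 by simp
      qed
      then have "1 * 3 \<le> (\<alpha> - 1) * (\<beta> - 1)" using al(1) by (intro mult_mono) auto
      moreover have "(\<alpha> + \<beta> - 1)\<^sup>2 \<le> (\<alpha> + \<beta> + 1 - int (card (nhd E \<inter> nhd R)))\<^sup>2"
        using j(2) al(1) be(1) by (intro power_mono) auto
      ultimately show False using sq by (simp add: power2_eq_square algebra_simps)
    qed
  qed
  then have "S = rbox a b c d" using ES by (auto simp: R_def E_def)
  then show ?thesis using t by blast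
qed

lemma optimal_insert:
  assumes "optimal S" "x \<in> evens" "x \<notin> S" "bsize (insert x S) \<le> bsize S"
  shows "optimal (insert x S)"
proof -
  have f: "finite S" using assms by (simp add: optimal_def)
  have "bsize (insert x S) \<ge> 4" using isoperimetric(1)[of "insert x S"] f by simp
  then have "(bsize (insert x S) - 3)\<^sup>2 \<le> (bsize S - 3)\<^sup>2"
    using assms by (intro power_mono) auto
  then show ?thesis using assms f by (simp add: optimal_def)
qed

text \<open>The 3 in \<open>optimal\<close> is 2 + 1: a boundary smaller by one would violate the
  isoperimetric inequality for \<open>T\<close>.\<close>

lemma optimal_bsize_le:
  assumes "optimal S" "finite T" "card S \<le> card T"
  shows "bsize S \<le> bsize T"
proof (rule ccontr)
  assume neg: "\<not> bsize S \<le> bsize T"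
  have "T \<noteq> {}" using assms by (auto simp: optimal_def card_gt_0_iff)
  note iso = isoperimetric[OF assms(2) this]
  have "(bsize T - 2)\<^sup>2 \<le> (bsize S - 3)\<^sup>2" using neg iso(1) by (intro power_mono) auto
  then show False using iso(2) assms by (simp add: optimal_def)
qed

lemma optimal_step:
  assumes "optimal S" "\<nexists>a b c d. tight a b c d \<and> S = rbox a b c d"
  obtains x where "x \<in> evens" "x \<notin> S" "optimal (insert x S)" "bsize (insert x S) = bsize S"
proof -
  have "\<not> filled S" using assms filled_optimal_eq_rbox by blast
  then obtain x where x: "x \<in> evens" "x \<notin> S" "bsize (insert x S) \<le> bsize S"
    by (auto simp: filled_def)
  have f: "finite S" using assms by (simp add: optimal_def)
  have "bsize S \<le> bsize (insert x S)"
    using f by (intro optimal_bsize_le[OF assms(1)]) (auto intro: card_mono)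
  with x show ?thesis using that optimal_insert[OF assms(1)] by auto
qed

text \<open>Free points are added until a box is reached. The isoperimetric inequality bounds the
  size for fixed \<open>bsize\<close>, which gives the decreasing measure.\<close>

lemma optimal_rbox_hull:
  assumes "optimal S"
  shows "\<exists>a b c d. tight a b c d \<and> S \<subseteq> rbox a b c d \<and> optimal (rbox a b c d)
    \<and> bsize (rbox a b c d) = bsize S"
  using assms
proof (induction "nat ((bsize S - 2)\<^sup>2) - card S" arbitrary: S rule: less_induct)
  case less
  show ?case
  proof (cases "\<exists>a b c d. tight a b c d \<and> S = rbox a b c d")
    case True
    then show ?thesis using less.prems by auto
  next
    case False
    then obtain x where x: "x \<in> evens" "x \<notin> S" "optimal (insert x S)" "bsize (insert x S) = bsize S"
      using optimal_step[OF less.prems] by metis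
    have f: "finite S" "S \<noteq> {}" using less.prems by (auto simp: optimal_def)
    have "8 * int (card (insert x S)) - 4 \<le> (bsize S - 2)\<^sup>2"
      using isoperimetric(2)[of "insert x S"] f x(4) by simp
    then have "card S < nat ((bsize S - 2)\<^sup>2)" using f x(2) by simp
    then have "nat ((bsize (insert x S) - 2)\<^sup>2) - card (insert x S) < nat ((bsize S - 2)\<^sup>2) - card S"
      using x f by simp
    from less.hyps[OF this x(3)] show ?thesis using x(4) by auto
  qed
qed

section \<open>Counting points of boxes\<close>

text \<open>Doubled to avoid halves; allowing \<open>c = d + 1\<close> lets the induction start with
  an empty column.\<close>

lemma card_rbox_col:
  assumes "c \<le> d + 1"
  shows "2 * int (card (rbox u u c d)) = (d - c + 1)
    + (if odd (d - c + 1) then if even (u + c) then 1 else -1 else 0)"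
proof -
  have "c - 1 \<le> d" using assms by simp
  then show ?thesis
  proof (induction d rule: int_ge_induct)
    case base
    have "rbox u u c (c - 1) = {}" by auto
    then show ?case by simp
  next
    case (step d)
    have "rbox u u c (d + 1) = (if even (u + (d + 1)) then insert (u, d + 1) (rbox u u c d) else rbox u u c d)"
      using step by (auto; presburger)
    moreover have "(u, d + 1) \<notin> rbox u u c d" by simp
    ultimately have "int (card (rbox u u c (d + 1))) = int (card (rbox u u c d)) + (if even (u + (d + 1)) then 1 else 0)"
      by simp
    then show ?case using step by (simp split: if_splits; presburger)
  qed
qed

lemma card_rbox:
  assumes "a \<le> b + 1" "c \<le> d + 1"
  shows "2 * int (card (rbox a b c d)) = (b - a + 1) * (d - c + 1)
    + (if odd (b - a + 1) \<and> odd (d - c + 1) then if even (a + c) then 1 else -1 else 0)"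
proof -
  have "a - 1 \<le> b" using assms by simp
  then show ?thesis
  proof (induction b rule: int_ge_induct)
    case base
    have "rbox a (a - 1) c d = {}" by auto
    then show ?case by simp
  next
    case (step b)
    have "rbox a (b + 1) c d = rbox a b c d \<union> rbox (b + 1) (b + 1) c d"
      using step by auto
    moreover have "rbox a b c d \<inter> rbox (b + 1) (b + 1) c d = {}" by auto
    ultimately have "card (rbox a (b + 1) c d) = card (rbox a b c d) + card (rbox (b + 1) (b + 1) c d)"
      by (simp add: card_Un_disjoint)
    then have eq: "2 * int (card (rbox a (b + 1) c d)) = 2 * int (card (rbox a b c d)) + 2 * int (card (rbox (b + 1) (b + 1) c d))"
      by simp
    have "(b + 1 - a + 1) * (d - c + 1) = (b - a + 1) * (d - c + 1) + (d - c + 1)"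
      by (simp add: algebra_simps)
    then show ?case
      unfolding eq card_rbox_col[OF assms(2)] using step by (simp split: if_splits; presburger)
  qed
qed

text \<open>Moving each side outwards by one preserves all parities in \<open>card_rbox\<close>, so
  the correction terms cancel.\<close>

lemma bsize_rbox:
  assumes "tight a b c d"
  shows "bsize (rbox a b c d) = (b - a + 1) + (d - c + 1) + 2"
proof -
  have ab: "a \<le> b" "c \<le> d" using assms by (auto simp: tight_def)
  let ?e = "if odd (b - a + 1) \<and> odd (d - c + 1) then if even (a + c) then 1 else -1 else (0::int)"
  have "2 * int (card (rbox a b c d)) = (b - a + 1) * (d - c + 1) + ?e"
    using ab by (intro card_rbox) auto
  moreover have "2 * int (card (rbox (a - 1) (b + 1) (c - 1) (d + 1))) = (b - a + 3) * (d - c + 3) + ?e"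
    using card_rbox[of "a - 1" "b + 1" "c - 1" "d + 1"] ab by (simp add: algebra_simps)
  ultimately show ?thesis
    unfolding bsize_def nhd_rbox[OF assms] by (simp add: algebra_simps)
qed

section \<open>Boxes that can be enlarged\<close>

text \<open>By the isoperimetric inequality, no set with more points than \<open>E\<close> has a boundary as small as that of \<open>E\<close>.\<close>

definition saturated :: "(int \<times> int) set \<Rightarrow> bool" where
  "saturated E \<longleftrightarrow> (bsize E - 2)\<^sup>2 < 8 * int (card E) + 4"

definition growing :: "(int \<times> int) set \<Rightarrow> bool" where
  "growing E \<longleftrightarrow> (\<exists>a b c d x. tight a b c d \<and> saturated (rbox a b c d) \<and> x \<notin> E
     \<and> insert x E \<subseteq> rbox a b c d \<and> bsize (insert x E) = bsize (rbox a b c d) \<and> optimal (insert x E))"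

lemma optimal_reflect: "optimal S \<Longrightarrow> optimal (reflect S)"
  unfolding optimal_def
  by (metis bsize_reflect card_reflect evens_reflect finite_reflect reflect_image image_is_empty reflect_mono)

lemma optimal_swap_uv: "optimal S \<Longrightarrow> optimal (swap_uv S)"
  unfolding optimal_def
  by (metis bsize_swap_uv card_swap_uv evens_swap_uv finite_swap_uv swap_uv_image image_is_empty swap_uv_mono)

lemma saturated_reflect: "saturated (reflect S) \<longleftrightarrow> saturated S"
  by (simp add: saturated_def)

lemma saturated_swap_uv: "saturated (swap_uv S) \<longleftrightarrow> saturated S"
  by (simp add: saturated_def)

lemma growing_reflect:
  assumes "growing (reflect E)"
  shows "growing E"
proof -
  obtain a b c d u v where *: "tight a b c d" "saturated (rbox a b c d)" "(u, v) \<notin> reflect E"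
    "insert (u, v) (reflect E) \<subseteq> rbox a b c d" "bsize (insert (u, v) (reflect E)) = bsize (rbox a b c d)"
    "optimal (insert (u, v) (reflect E))"
    using assms unfolding growing_def by (metis surj_pair)
  have eq: "insert (- u, v) E = reflect (insert (u, v) (reflect E))"
    by (simp add: insert_symmetries)
  have "insert (- u, v) E \<subseteq> rbox (- b) (- a) c d"
    using *(4) unfolding eq rbox_reflect[symmetric] reflect_mono .
  moreover have "bsize (insert (- u, v) E) = bsize (rbox (- b) (- a) c d)"
    using *(5) unfolding eq rbox_reflect[symmetric] bsize_reflect .
  moreover have "optimal (insert (- u, v) E)" unfolding eq using *(6) by (rule optimal_reflect)
  moreover have "tight (- b) (- a) c d" using *(1) by (simp add: tight_reflect)
  moreover have "saturated (rbox (- b) (- a) c d)"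
    using *(2) unfolding rbox_reflect[symmetric] saturated_reflect .
  moreover have "(- u, v) \<notin> E" using *(3) by simp
  ultimately show ?thesis unfolding growing_def by blast
qed

lemma growing_swap_uv:
  assumes "growing (swap_uv E)"
  shows "growing E"
proof -
  obtain a b c d u v where *: "tight a b c d" "saturated (rbox a b c d)" "(u, v) \<notin> swap_uv E"
    "insert (u, v) (swap_uv E) \<subseteq> rbox a b c d" "bsize (insert (u, v) (swap_uv E)) = bsize (rbox a b c d)"
    "optimal (insert (u, v) (swap_uv E))"
    using assms unfolding growing_def by (metis surj_pair)
  have eq: "insert (v, u) E = swap_uv (insert (u, v) (swap_uv E))"
    by (simp add: insert_symmetries)
  have "insert (v, u) E \<subseteq> rbox c d a b"
    using *(4) unfolding eq rbox_swap_uv[of a b c d, symmetric] swap_uv_mono .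
  moreover have "bsize (insert (v, u) E) = bsize (rbox c d a b)"
    using *(5) unfolding eq rbox_swap_uv[of a b c d, symmetric] bsize_swap_uv .
  moreover have "optimal (insert (v, u) E)" unfolding eq using *(6) by (rule optimal_swap_uv)
  moreover have "tight c d a b" using *(1) by (simp add: tight_swap_uv)
  moreover have "saturated (rbox c d a b)"
    using *(2) unfolding rbox_swap_uv[of a b c d, symmetric] saturated_swap_uv .
  moreover have "(v, u) \<notin> E" using *(3) by simp
  ultimately show ?thesis unfolding growing_def by blast
qed

text \<open>A saturated box is almost square, and widening its shorter side keeps it so.
  \<open>par\<close> excludes the wider box with two odd sides and odd corners, which holds one
  point less than its non-corner colour.\<close>

lemma growing_right:
  assumes t: "tight a b c d" and sat: "saturated (rbox a b c d)" and "c < d" "b - a \<le> d - c"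
    and par: "\<not> (odd (b - a) \<and> even (d - c) \<and> odd (a + c))"
  shows "growing (rbox a b c d)"
proof -
  let ?E = "rbox a b c d" and ?E' = "rbox a (b + 1) c d"
  define P Q where "P = b - a + 1" and "Q = d - c + 1"
  have ab: "a \<le> b" using t by (simp add: tight_def)
  have t': "tight a (b + 1) c d" using ab assms(3) by (simp add: tight_def)
  have bE: "bsize ?E = P + Q + 2" and bE': "bsize ?E' = P + 1 + Q + 2"
    using bsize_rbox[OF t] bsize_rbox[OF t'] by (simp_all add: P_def Q_def)
  obtain e :: int where e: "2 * int (card ?E) = P * Q + e" "e \<le> 1"
    using card_rbox[of a b c d] ab assms(3) unfolding P_def Q_def by fastforce
  obtain e' :: int where e': "2 * int (card ?E') = (P + 1) * Q + e'" "0 \<le> e'"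
  proof -
    have "\<not> (odd (b + 1 - a + 1) \<and> odd (d - c + 1) \<and> odd (a + c))" using par by auto
    then show ?thesis
      using that card_rbox[of a "b + 1" c d] ab assms(3) unfolding P_def Q_def
      by (auto simp: algebra_simps split: if_splits)
  qed
  \<comment> \<open>Saturation in terms of side lengths: only the differences 0, 1 and 2 remain, and
    widening by one column brings them to at most 1 in absolute value.\<close>
  have "(Q - P)\<^sup>2 < 9"
    using sat e unfolding saturated_def bE by (simp add: power2_eq_square algebra_simps)
  then have "Q - P < 3" using power2_less_imp_less[of "Q - P" 3] by simp
  moreover have "0 \<le> Q - P" using assms(4) by (simp add: P_def Q_def)
  ultimately have "Q - P = 0 \<or> Q - P = 1 \<or> Q - P = 2" by linarith
  then have "(Q - P - 1)\<^sup>2 \<le> 1" by auto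
  then have sat': "saturated ?E'"
    using e' unfolding saturated_def bE' by (simp add: power2_eq_square algebra_simps)
  obtain v where v: "c \<le> v" "v \<le> d" "even (b + 1 + v)"
  proof (cases "even (b + 1 + c)")
    case True then show ?thesis using that[of c] assms(3) by simp
  next
    case False then show ?thesis using that[of "c + 1"] assms(3) by simp
  qed
  let ?x = "(b + 1, v)"
  have x: "?x \<notin> ?E" by simp
  have sub: "insert ?x ?E \<subseteq> ?E'" using v ab by auto
  have "nhd (insert ?x ?E) = nhd ?E \<union> nhd {?x}" using nhd_Un[of ?E "{?x}"] by simp
  also have "nhd {?x} = {(b + 1, v), (b + 2, v + 1), (b + 2, v - 1), (b, v + 1), (b, v - 1)}"
    by (auto simp: nhd_def)
  also have "nhd ?E \<union> \<dots> \<subseteq> nhd ?E \<union> set [(b + 2, v + 1), (b + 2, v - 1)]"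
    unfolding nhd_rbox[OF t] using v ab by auto
  finally have "bsize (insert ?x ?E) \<le> bsize ?E + 1"
    using bsize_insert_le[of ?E ?x "[(b + 2, v + 1), (b + 2, v - 1)]"] x by simp
  moreover have "bsize ?E < bsize (insert ?x ?E)"
  proof -
    have "insert ?x ?E \<inter> ?E = ?E" by auto
    moreover have "insert ?x ?E \<subseteq> evens" using v by auto
    ultimately show ?thesis using bsize_Int_rbox[of "insert ?x ?E" a b c d] x by simp
  qed
  ultimately have bx: "bsize (insert ?x ?E) = bsize ?E + 1" by simp
  \<comment> \<open>One more point and one more boundary point turn the inequality of
    \<open>saturated\<close> into that of \<open>optimal\<close>.\<close>
  have "optimal (insert ?x ?E)"
    using sat x v unfolding optimal_def saturated_def bx by auto
  moreover have "bsize (insert ?x ?E) = bsize ?E'" using bx bE bE' by simp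
  ultimately show ?thesis unfolding growing_def using t' sat' x sub by blast
qed

lemma growing_if_saturated:
  assumes t: "tight a b c d" and sat: "saturated (rbox a b c d)"
  shows "growing (rbox a b c d)"
proof -
  have wide: "growing (rbox a b c d)"
    if t: "tight a b c d" and sat: "saturated (rbox a b c d)" and "c < d" "b - a \<le> d - c" for a b c d
  proof (cases "odd (b - a) \<and> even (d - c) \<and> odd (a + c)")
    case False
    then show ?thesis using growing_right that by blast
  next
    case True
    \<comment> \<open>As \<open>b - a\<close> is odd, the right corners have the other parity, so
      the box is widened to the left instead.\<close>
    have "growing (rbox (- b) (- a) c d)"
    proof (rule growing_right)
      show "tight (- b) (- a) c d" using t by (simp add: tight_reflect)
      show "saturated (rbox (- b) (- a) c d)"
        using sat unfolding rbox_reflect[symmetric] saturated_reflect .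
      show "\<not> (odd (- a - - b) \<and> even (d - c) \<and> odd (- b + c))" using True by auto
    qed (use that in auto)
    then show ?thesis unfolding rbox_reflect[symmetric] by (rule growing_reflect)
  qed
  consider "c < d" "b - a \<le> d - c" | "a < b" "d - c \<le> b - a" | "a = b" "c = d"
    using t unfolding tight_def by linarith
  then show ?thesis
  proof cases
    case 1 then show ?thesis using wide t sat by blast
  next
    case 2
    have "growing (rbox c d a b)"
    proof (rule wide)
      show "tight c d a b" using t by (simp add: tight_swap_uv)
      show "saturated (rbox c d a b)"
        using sat unfolding rbox_swap_uv[of a b c d, symmetric] saturated_swap_uv .
    qed (use 2 in auto)
    then show ?thesis unfolding rbox_swap_uv[of a b c d, symmetric] by (rule growing_swap_uv)
  next
    case 3
    \<comment> \<open>A single point has no longer side to widen along; it grows to two diagonal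
      points.\<close>
    let ?E' = "rbox a (a + 1) c (c + 1)"
    have ev: "even (a + c)" using t 3 by (simp add: tight_def)
    have E: "rbox a b c d = {(a, c)}" using 3 ev by auto
    have E': "?E' = insert (a + 1, c + 1) {(a, c)}" using ev by (auto; presburger)
    have t': "tight a (a + 1) c (c + 1)" by (simp add: tight_def)
    have b': "bsize ?E' = 6" using bsize_rbox[OF t'] by simp
    have c': "card ?E' = 2" unfolding E' by simp
    have "saturated ?E'" by (simp add: saturated_def b' c')
    moreover have "optimal ?E'" using rbox_evens c' by (auto simp: optimal_def b' simp del: mem_rbox)
    ultimately show ?thesis
      unfolding growing_def E using t' E' by (metis add_cancel_left_right insertI1 order_refl prod.inject singletonD zero_neq_one)
  qed
qed

section \<open>Endless growth and optimal sets of every size\<close>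

definition thriving :: "(int \<times> int) set \<Rightarrow> bool" where
  "thriving S \<longleftrightarrow> optimal S \<and> (\<exists>a b c d. tight a b c d \<and> S \<subseteq> rbox a b c d
     \<and> bsize (rbox a b c d) = bsize S \<and> saturated (rbox a b c d))"

text \<open>Inside its box the set is filled up by free points, which cannot leave the box because
  cutting back to it would lower \<open>bsize\<close>; a full box moves on to the next saturated
  one.\<close>

lemma thriving_step:
  assumes "thriving S"
  shows "\<exists>x. x \<notin> S \<and> thriving (insert x S)"
proof -
  obtain a b c d where t: "tight a b c d" and sub: "S \<subseteq> rbox a b c d"
    and eq: "bsize (rbox a b c d) = bsize S" and sat: "saturated (rbox a b c d)" and opt: "optimal S"
    using assms by (auto simp: thriving_def)
  show ?thesis
  proof (cases "S = rbox a b c d")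
    case True
    then show ?thesis
      using growing_if_saturated[OF t sat] unfolding growing_def thriving_def by metis
  next
    case False
    have "S \<noteq> rbox a' b' c' d'" for a' b' c' d'
    proof
      assume S: "S = rbox a' b' c' d'"
      then have "rbox a b c d \<inter> rbox a' b' c' d' = S" "\<not> rbox a b c d \<subseteq> rbox a' b' c' d'"
        using sub False by auto
      then show False
        using bsize_Int_rbox[of "rbox a b c d" a' b' c' d'] rbox_evens eq by simp
    qed
    then obtain x where x: "x \<in> evens" "x \<notin> S" "optimal (insert x S)" "bsize (insert x S) = bsize S"
      using optimal_step[OF opt] by metis
    have "x \<in> rbox a b c d"
    proof (rule ccontr)
      assume "x \<notin> rbox a b c d"
      then have "insert x S \<inter> rbox a b c d = S" "\<not> insert x S \<subseteq> rbox a b c d" using sub by auto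
      then show False
        using bsize_Int_rbox[of "insert x S" a b c d] x unfolding optimal_def by simp
    qed
    then show ?thesis using x t sub eq sat unfolding thriving_def by (metis insert_subset)
  qed
qed

lemma thriving_point: "thriving {(0, 0)}"
proof -
  have t: "tight 0 0 0 0" by (simp add: tight_def)
  have E: "rbox 0 0 0 0 = {(0, 0)}" by auto
  have b: "bsize {(0, 0)} = 4" using bsize_rbox[OF t] E by simp
  have "optimal {(0, 0)}" by (simp add: optimal_def b)
  moreover have "saturated {(0, 0)}" by (simp add: saturated_def b)
  ultimately show ?thesis unfolding thriving_def using t E by (metis order_refl)
qed

lemma ex_optimal:
  assumes "n \<ge> 1"
  shows "\<exists>S. optimal S \<and> card S = n"
proof -
  have "\<exists>S. thriving S \<and> card S = Suc m" for m
  proof (induction m)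
    case 0 show ?case using thriving_point by (intro exI[of _ "{(0, 0)}"]) simp
  next
    case (Suc m)
    then obtain S where S: "thriving S" "card S = Suc m" by auto
    obtain x where "x \<notin> S" "thriving (insert x S)" using thriving_step[OF S(1)] by auto
    moreover have "finite S" using S(2) card.infinite by fastforce
    ultimately show ?case using S(2) by (intro exI[of _ "insert x S"]) simp
  qed
  from this[of "n - 1"] show ?thesis using assms by (auto simp: thriving_def)
qed

section \<open>Mortality\<close>

definition rot :: "point \<Rightarrow> int \<times> int" where
  "rot = (\<lambda>(x, y). (y - x, y + x))"

lemma inj_rot: "inj rot"
  by (auto simp: rot_def inj_def)

lemma card_rot [simp]: "card (rot ` A) = card A"
  by (rule card_image) (use inj_rot in \<open>auto intro: inj_on_subset\<close>)

lemma finite_rot [simp]: "finite (rot ` A) \<longleftrightarrow> finite A"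
  using finite_image_iff[of rot A] inj_rot by (simp add: inj_on_subset)

lemma rot_subset_iff [simp]: "rot ` A \<subseteq> rot ` B \<longleftrightarrow> A \<subseteq> B"
  using inj_rot by (rule inj_image_subset_iff)

lemma rot_evens: "rot ` A \<subseteq> evens"
  by (auto simp: rot_def)

lemma evens_rotE:
  fixes u v :: int
  assumes "even (u + v)"
  obtains x y where "u = y - x" "v = y + x"
proof -
  obtain k where "u + v = 2 * k" using assms by blast
  then have "u = k - (v - k)" "v = k + (v - k)" by auto
  then show thesis by (rule that)
qed

lemma rot_UNIV: "range rot = evens"
proof
  show "evens \<subseteq> range rot"
  proof clarify
    fix u v assume "(u, v) \<in> evens"
    then obtain x y where "u = y - x" "v = y + x" using evens_rotE[of u v] by (metis mem_evens)
    then show "(u, v) \<in> range rot" by (intro image_eqI[of _ _ "(x, y)"]) (auto simp: rot_def)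
  qed
qed (use rot_evens in auto)

lemma evens_eq_rot:
  assumes "T \<subseteq> evens"
  shows "\<exists>A. T = rot ` A"
  using assms rot_UNIV subset_imageE by metis

lemma rot_mem [simp]: "(y - x, y + x) \<in> rot ` A \<longleftrightarrow> (x, y) \<in> A"
  using inj_image_mem_iff[OF inj_rot, of "(x, y)" A] by (simp add: rot_def)

lemma rot_mem_step:
  "(y - x - 1, y + x - 1) \<in> rot ` A \<longleftrightarrow> (x, y - 1) \<in> A"
  "(y - x - 1, y + x + 1) \<in> rot ` A \<longleftrightarrow> (x + 1, y) \<in> A"
  "(y - x + 1, y + x - 1) \<in> rot ` A \<longleftrightarrow> (x - 1, y) \<in> A"
  "(y - x + 1, y + x + 1) \<in> rot ` A \<longleftrightarrow> (x, y + 1) \<in> A"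
  using rot_mem[of "y - 1" x A] rot_mem[of y "x + 1" A] rot_mem[of y "x - 1" A] rot_mem[of "y + 1" x A]
  by (simp_all add: algebra_simps)

lemma nhd_evens: "S \<subseteq> evens \<Longrightarrow> nhd S \<subseteq> evens"
  unfolding nhd_def evens_def by fastforce

lemma adjacent_iff:
  "adjacent (x, y) q \<longleftrightarrow> q \<in> {(x, y - 1), (x + 1, y), (x - 1, y), (x, y + 1)}"
  by (cases q) (auto simp: adjacent_def)

lemma nhd_rot: "nhd (rot ` A) = rot ` (A \<union> vboundary A)"
proof -
  have *: "(y - x, y + x) \<in> nhd (rot ` A) \<longleftrightarrow> (x, y) \<in> A \<union> vboundary A" for x y
    unfolding nhd_def vboundary_def by (auto simp: rot_mem_step adjacent_iff)
  have "(u, v) \<in> nhd (rot ` A) \<longleftrightarrow> (u, v) \<in> rot ` (A \<union> vboundary A)" for u v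
  proof (cases "even (u + v)")
    case True
    then obtain x y where "u = y - x" "v = y + x" using evens_rotE by metis
    then show ?thesis using * rot_mem by simp
  next
    case False
    then show ?thesis
      using nhd_evens[OF rot_evens[of A]] rot_evens[of "A \<union> vboundary A"] mem_evens by blast
  qed
  then show ?thesis by (simp add: set_eq_iff del: Un_iff)
qed

lemma bsize_rot:
  assumes "finite A"
  shows "bsize (rot ` A) = int (card (vboundary A))"
proof -
  have "finite (nhd (rot ` A))" using assms by simp
  then have "finite (vboundary A)" unfolding nhd_rot by simp
  moreover have "A \<inter> vboundary A = {}" by (auto simp: vboundary_def)
  ultimately show ?thesis
    using assms by (simp add: bsize_def nhd_rot card_Un_disjoint del: image_Un Un_iff)
qed

lemma rot_Box: "rot ` Box a b c d = rbox a b c d"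
proof -
  have "(u, v) \<in> rot ` Box a b c d \<longleftrightarrow> (u, v) \<in> rbox a b c d" for u v
  proof (cases "even (u + v)")
    case True
    then obtain x y where "u = y - x" "v = y + x" using evens_rotE by metis
    then show ?thesis by (simp add: Box_def)
  next
    case False
    then have "(u, v) \<notin> rot ` Box a b c d" using rot_evens[of "Box a b c d"] mem_evens by blast
    then show ?thesis using False by simp
  qed
  then show ?thesis by (metis subsetI subset_antisym surj_pair)
qed

text \<open>An optimal set of the same size exists by \<open>ex_optimal\<close>, and a minimal set
  has no larger boundary; the converse is \<open>optimal_bsize_le\<close>.\<close>

lemma minimal_iff_optimal: "minimal A \<longleftrightarrow> optimal (rot ` A)"
proof
  assume A: "minimal A"
  then have fin: "finite A" "A \<noteq> {}" by (auto simp: minimal_def)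
  then have "card A \<ge> 1" by (simp add: Suc_leI card_gt_0_iff)
  then obtain S where S: "optimal S" "card S = card A" using ex_optimal by blast
  then obtain C where C: "S = rot ` C" using evens_eq_rot unfolding optimal_def by blast
  have finC: "finite C" using S C by (simp add: optimal_def)
  have "card (vboundary A) \<le> card (vboundary C)"
    using A S finC C by (auto simp: minimal_def)
  then have "bsize (rot ` A) \<le> bsize S" using fin finC C by (simp add: bsize_rot)
  moreover have "bsize (rot ` A) \<ge> 4" using isoperimetric(1)[of "rot ` A"] fin by simp
  ultimately have "(bsize (rot ` A) - 3)\<^sup>2 \<le> (bsize S - 3)\<^sup>2" by (intro power_mono) auto
  then show "optimal (rot ` A)" using S fin rot_evens by (simp add: optimal_def)
next
  assume opt: "optimal (rot ` A)"
  then have fin: "finite A" "A \<noteq> {}" by (auto simp: optimal_def)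
  have "card (vboundary A) \<le> card (vboundary C)" if "finite C" "card C = card A" for C
    using optimal_bsize_le[OF opt, of "rot ` C"] that fin by (simp add: bsize_rot)
  then show "minimal A" using fin by (simp add: minimal_def)
qed

text \<open>The box filled up from \<open>A\<close> cannot exceed \<open>enc A\<close>: its
  intersection with \<open>enc A\<close> would have smaller \<open>bsize\<close> than
  \<open>A\<close>, yet still contain \<open>A\<close>.\<close>

lemma enc_minimal:
  assumes "minimal A"
  obtains a b c d where "tight a b c d" "rot ` enc A = rbox a b c d" "A \<subseteq> enc A"
    "minimal (enc A)" "bsize (rbox a b c d) = bsize (rot ` A)"
proof -
  have opt: "optimal (rot ` A)" using assms minimal_iff_optimal by simp
  have fin: "finite A" "A \<noteq> {}" using assms by (auto simp: minimal_def)
  note e = enc_smallest_box[OF fin]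
  obtain a b c d where E: "tight a b c d" "rot ` A \<subseteq> rbox a b c d" "optimal (rbox a b c d)"
    "bsize (rbox a b c d) = bsize (rot ` A)"
    using optimal_rbox_hull[OF opt] by blast
  have AB: "A \<subseteq> Box a b c d" using E(2) unfolding rot_Box[symmetric] by simp
  then have "enc A \<subseteq> Box a b c d" using fin by (intro e(3)) (auto simp: is_box_def)
  moreover have "Box a b c d \<subseteq> enc A"
  proof (rule ccontr)
    assume neg: "\<not> Box a b c d \<subseteq> enc A"
    obtain a' b' c' d' where enc: "enc A = Box a' b' c' d'" using e(1) by (auto simp: is_box_def)
    let ?T = "rbox a b c d \<inter> rbox a' b' c' d'"
    have "\<not> rbox a b c d \<subseteq> rbox a' b' c' d'"
      using neg unfolding enc rot_Box[symmetric] by simp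
    then have "bsize ?T < bsize (rot ` A)"
      using bsize_Int_rbox[of "rbox a b c d" a' b' c' d'] rbox_evens E(4) by simp
    moreover have "rot ` A \<subseteq> ?T"
      using AB e(2) unfolding enc rot_Box[symmetric] by auto
    then have "bsize (rot ` A) \<le> bsize ?T"
      using opt by (intro optimal_bsize_le card_mono) auto
    ultimately show False by simp
  qed
  ultimately have "enc A = Box a b c d" by blast
  then show thesis
    using that[of a b c d] E e(2) by (simp add: rot_Box minimal_iff_optimal)
qed

section \<open>Nested sequences and life expectancy\<close>

lemma nested_minimal_seq_if_thriving:
  assumes "thriving (rot ` A)"
  shows "\<exists>S. nested_minimal_seq A n S"
proof -
  have step: "\<exists>x. x \<notin> B \<and> thriving (rot ` insert x B)" if B: "thriving (rot ` B)" for B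
  proof -
    obtain p where p: "p \<notin> rot ` B" "thriving (insert p (rot ` B))" using thriving_step[OF B] by auto
    then have "p \<in> range rot" by (auto simp: rot_UNIV thriving_def optimal_def)
    then show ?thesis using p by auto
  qed
  then obtain g where g: "\<And>B. thriving (rot ` B) \<Longrightarrow> g B \<notin> B \<and> thriving (rot ` insert (g B) B)"
    by metis
  define S where "S i = ((\<lambda>B. insert (g B) B) ^^ i) A" for i
  have S: "thriving (rot ` S i) \<and> card (S i) = card A + i" for i
  proof (induction i)
    case 0 then show ?case using assms by (simp add: S_def)
  next
    case (Suc i)
    have "finite (S i)" using Suc by (simp add: thriving_def optimal_def)
    moreover have "S (Suc i) = insert (g (S i)) (S i)" by (simp add: S_def)
    ultimately show ?case using g[of "S i"] Suc by simp
  qed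
  have "minimal (S i)" for i using S[of i] by (simp add: minimal_iff_optimal thriving_def)
  moreover have "S i \<subseteq> S (Suc i)" for i by (auto simp: S_def)
  moreover have "S 0 = A" by (simp add: S_def)
  ultimately show ?thesis unfolding nested_minimal_seq_def using S by blast
qed

lemma nested_minimal_seq_mono:
  assumes "nested_minimal_seq A n S" "i \<le> j" "j \<le> n"
  shows "S i \<subseteq> S j"
  using assms(2,3)
proof (induction rule: dec_induct)
  case (step k)
  then have "S k \<subseteq> S (Suc k)" using assms(1) by (simp add: nested_minimal_seq_def)
  then show ?case using step by simp
qed simp

lemma life_expectancy_ge: "nested_minimal_seq A n S \<Longrightarrow> enat n \<le> life_expectancy A"
  unfolding life_expectancy_def by (rule Sup_upper) blast

lemma life_expectancy_le:
  "(\<And>n S. nested_minimal_seq A n S \<Longrightarrow> n \<le> m) \<Longrightarrow> life_expectancy A \<le> enat m"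
  unfolding life_expectancy_def by (rule Sup_least) auto

theorem theorem8p6:
  assumes "minimal A"
  shows "mortal A \<longleftrightarrow> dead (enc A)"
proof -
  obtain a b c d where t: "tight a b c d" and rE: "rot ` enc A = rbox a b c d" and AE: "A \<subseteq> enc A"
    and minE: "minimal (enc A)" and bE: "bsize (rbox a b c d) = bsize (rot ` A)"
    using enc_minimal[OF assms] .
  have opt: "optimal (rot ` A)" and optE: "optimal (rbox a b c d)"
    using assms minE minimal_iff_optimal rE by auto
  have finE: "finite (enc A)" using minE by (simp add: minimal_def)
  show ?thesis
  proof
    assume mort: "mortal A"
    have "n \<le> 0" if seq: "nested_minimal_seq (enc A) n S" for n S
    proof (rule ccontr)
      assume n: "\<not> n \<le> 0"
      then have S: "minimal (S 1)" "card (S 1) = card (enc A) + 1" "enc A \<subseteq> S 1"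
        using seq by (auto simp: nested_minimal_seq_def)
      let ?T = "rot ` S 1"
      have optT: "optimal ?T" using S minimal_iff_optimal by simp
      have "S 1 \<noteq> enc A" using S(2) by auto
      then have "\<not> ?T \<subseteq> rbox a b c d" using S(3) unfolding rE[symmetric] by auto
      moreover have "?T \<inter> rbox a b c d = rbox a b c d" using S(3) unfolding rE[symmetric] by auto
      ultimately have "bsize (rbox a b c d) < bsize ?T"
        using bsize_Int_rbox[of ?T a b c d] optT by (simp add: optimal_def)
      moreover have "bsize (rbox a b c d) \<ge> 4"
        using optE isoperimetric(1) by (auto simp: optimal_def)
      \<comment> \<open>A minimal set one point larger than the box has strictly larger boundary, so
        its optimality makes the box saturated. Then \<open>A\<close> itself is thriving and never
        stops growing.\<close>
      ultimately have "(bsize (rbox a b c d) - 2)\<^sup>2 \<le> (bsize ?T - 3)\<^sup>2" by (intro power_mono) auto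
      moreover have "card (rbox a b c d) = card (enc A)" using rE card_rot by metis
      ultimately have "saturated (rbox a b c d)"
        using optT S(2) by (simp add: optimal_def saturated_def)
      moreover have "rot ` A \<subseteq> rbox a b c d" using AE unfolding rE[symmetric] by simp
      ultimately have "thriving (rot ` A)"
        unfolding thriving_def using opt t bE by blast
      then have "enat m \<le> life_expectancy A" for m
        using nested_minimal_seq_if_thriving life_expectancy_ge by blast
      moreover obtain m where "life_expectancy A = enat m"
        using mort unfolding mortal_def by (auto simp: less_infinityE)
      ultimately show False by (metis enat_ord_simps(1) Suc_n_not_le_n)
    qed
    then have "life_expectancy (enc A) \<le> enat 0" by (rule life_expectancy_le)
    then show "dead (enc A)" using minE by (simp add: dead_def zero_enat_def[symmetric])
  next
    assume dead: "dead (enc A)"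
    let ?m = "card (enc A) - card A"
    have cA: "card A \<le> card (enc A)" using AE finE by (rule card_mono[rotated])
    have "n \<le> ?m" if seq: "nested_minimal_seq A n S" for n S
    proof (rule ccontr)
      assume n: "\<not> n \<le> ?m"
      \<comment> \<open>After \<open>?m\<close> steps the sequence has as many points as
        \<open>enc A\<close>. It is shown to be \<open>enc A\<close> there, so \<open>?C\<close>
        would continue a dead set.\<close>
      let ?B = "S ?m" and ?C = "S (Suc ?m)"
      have B: "minimal ?B" "card ?B = card (enc A)" and C: "minimal ?C" "card ?C = Suc (card (enc A))"
        and BC: "?B \<subseteq> ?C"
        using seq n cA by (auto simp: nested_minimal_seq_def)
      have AB: "A \<subseteq> ?B"
        using nested_minimal_seq_mono[OF seq, of 0 ?m] n seq by (simp add: nested_minimal_seq_def)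
      have optB: "optimal (rot ` ?B)" using B minimal_iff_optimal by simp
      have cE: "card (rbox a b c d) = card ?B" using rE B(2) card_rot by metis
      \<comment> \<open>Otherwise cutting \<open>?B\<close> to the box gives a superset of
        \<open>A\<close> with smaller boundary than \<open>?B\<close>, hence than \<open>A\<close>,
        whose boundary is as large as that of the box.\<close>
      have "?B \<subseteq> enc A"
      proof (rule ccontr)
        assume "\<not> ?B \<subseteq> enc A"
        then have "\<not> rot ` ?B \<subseteq> rbox a b c d" unfolding rE[symmetric] by simp
        then have "bsize (rot ` ?B \<inter> rbox a b c d) < bsize (rot ` ?B)"
          using optB by (intro bsize_Int_rbox) (auto simp: optimal_def)
        also have "bsize (rot ` ?B) \<le> bsize (rot ` A)"
          using optimal_bsize_le[OF optB, of "rbox a b c d"] cE bE by simp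
        also have "rot ` A \<subseteq> rot ` ?B \<inter> rbox a b c d" using AB AE unfolding rE[symmetric] by auto
        then have "bsize (rot ` A) \<le> bsize (rot ` ?B \<inter> rbox a b c d)"
          by (intro optimal_bsize_le[OF opt] card_mono) auto
        finally show False by simp
      qed
      then have "?B = enc A" using B(2) finE card_subset_eq by metis
      then have "nested_minimal_seq (enc A) 1 (\<lambda>i. if i = 0 then enc A else ?C)"
        using BC C minE by (auto simp: nested_minimal_seq_def le_Suc_eq)
      then have "enat 1 \<le> life_expectancy (enc A)" by (rule life_expectancy_ge)
      then show False using dead by (simp add: dead_def zero_enat_def)
    qed
    then have "life_expectancy A \<le> enat ?m" by (rule life_expectancy_le)
    then have "life_expectancy A < \<infinity>" by (rule le_less_trans) simp
    then show "mortal A" using assms unfolding mortal_def by blast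
  qed
qed

end
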